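(* For every integer $n\ge1$, \[m_{\mathbb{H}}\big((x-i)^{\ast n}\big)=\frac{2n}{\pi}\int_0^\infty t\coth(nt)\tanh^2(t)\operatorname{sech}(t)\,dt-\frac{2+n}{4}.\] In particular $m_{\mathbb{H}}(x^2-2xi-1)=\tfrac56$ and $m_{\mathbb{H}}(x^3-3x^2i-3x+i)=\tfrac{31}{4}-2\pi$.
   Context: $\mathbb{H}$ denotes the quaternions; $m_{\mathbb{H}}(P)=\int_{|x|=1}\log|P(x)|\,d\mu(x)$ where $\mu$ is the probability Haar measure on the unit quaternions $S^3\subset\mathbb{H}$. A slice regular polynomial is $P(x)=\sum_\ell x^\ell a_\ell$ with $a_\ell\in\mathbb{H}$ on the right. The $\ast$-product of $P=\sum x^\ell a_\ell$, $Q=\sum x^\ell b_\ell$ is $(P\ast Q)(x)=\sum_n x^n\sum_{l=0}^n a_lb_{n-l}$, and $(x-i)^{\ast n}$ denotes the $n$-fold $\ast$-product of the slice regular polynomial $x-i$ with itself (e.g. $(x-i)^{\ast2}=x^2-2xi-1$). *)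

theory Defs
  imports "HOL-Analysis.Analysis"
begin

text \<open>A quaternion q = a + b j with a, b complex (a = a0 + a1 i, b = b0 + b1 i) is
  represented by the pair (a, b). The product-space norm on complex * complex is the
  Euclidean norm of R^4, so this is exactly H = R^4 with |q| the quaternion modulus,
  and lborel on this type is Lebesgue measure on R^4.\<close>

type_synonym quat = "complex \<times> complex"

definition qmult :: "quat \<Rightarrow> quat \<Rightarrow> quat" where
  "qmult p q = (fst p * fst q - snd p * cnj (snd q), fst p * snd q + snd p * cnj (fst q))"

definition qone :: quat where "qone = (1, 0)"

definition qi :: quat where "qi = (\<i>, 0)"

fun qpow :: "quat \<Rightarrow> nat \<Rightarrow> quat" where
  "qpow x 0 = qone"
| "qpow x (Suc n) = qmult (qpow x n) x"

text \<open>A slice regular polynomial sum_l x^l a_l is given by its (finitely supported)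
  coefficient function a :: nat => quat, coefficients acting on the right.\<close>

definition sr_eval :: "(nat \<Rightarrow> quat) \<Rightarrow> quat \<Rightarrow> quat" where
  "sr_eval a x = (\<Sum>l\<in>{l. a l \<noteq> 0}. qmult (qpow x l) (a l))"

definition star_prod :: "(nat \<Rightarrow> quat) \<Rightarrow> (nat \<Rightarrow> quat) \<Rightarrow> (nat \<Rightarrow> quat)" where
  "star_prod a b = (\<lambda>n. \<Sum>l\<in>{0..n}. qmult (a l) (b (n - l)))"

definition sr_one :: "nat \<Rightarrow> quat" where
  "sr_one = (\<lambda>l. if l = 0 then qone else 0)"

fun star_pow :: "(nat \<Rightarrow> quat) \<Rightarrow> nat \<Rightarrow> (nat \<Rightarrow> quat)" where
  "star_pow a 0 = sr_one"
| "star_pow a (Suc n) = star_prod (star_pow a n) a"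

definition x_minus_i :: "nat \<Rightarrow> quat" where
  "x_minus_i = (\<lambda>l. if l = 0 then - qi else if l = 1 then qone else 0)"

text \<open>The probability Haar measure on the unit quaternions S^3 is the normalized
  (rotation invariant) surface measure on the unit sphere of R^4; we realize it as the
  cone measure: the push-forward of normalized Lebesgue measure on the unit ball under
  radial projection x / |x|.\<close>

definition haar_S3 :: "quat measure" where
  "haar_S3 = distr (uniform_measure lborel (ball 0 1)) borel (\<lambda>x. x /\<^sub>R norm x)"

definition mahler_H :: "(nat \<Rightarrow> quat) \<Rightarrow> real" where
  "mahler_H a = (\<integral>x. ln (norm (sr_eval a x)) \<partial>haar_S3)"

end

theory Submission
  imports Defs "HOL-Real_Asymp.Real_Asymp"
begin

text \<open>The first complex coordinate of a Haar-random unit quaternion is uniform on the unit disc. For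
  \<open>x = \<alpha> + J \<beta>\<close> with \<open>|x| = 1\<close> the representation formula gives
  \<open>|P(x)|\<^sup>2 = (1 + s)/2 (2 - 2\<beta>)^n + (1 - s)/2 (2 + 2\<beta>)^n\<close>, where \<open>s \<beta>\<close> is the \<open>i\<close>-component of
  \<open>x\<close>. Thus \<open>ln |P|\<^sup>2\<close> is the logarithm of a linear function on each chord \<open>Re = \<alpha>\<close> of the
  disc; its integral is explicit, and the substitution \<open>\<alpha> = - sech t\<close>, \<open>\<beta> = tanh t\<close> yields the
  integral over \<open>t\<close>. The constant comes from \<open>\<integral> ln (cosh t) sech t dt = (\<pi>/2) ln 2\<close> over
  \<open>(0, \<infinity>)\<close>; the case \<open>n = 2\<close> is elementary, and \<open>n = 3\<close> reduces to
  \<open>\<integral> ln ((2 cosh t + 1)/(2 cosh t - 1)) dt = \<pi>\<^sup>2/6\<close>.\<close>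

section \<open>The first coordinate of a Haar-random unit quaternion\<close>

text \<open>Two facts remove the sphere from the problem. The coefficients of the star powers are
  complex, so |P(x)| depends on x only through its first coordinate; and the projection from the
  three-sphere to the disc has constant density, so no weight enters the planar integral. The chord
  formula is linear because its two end values are |P|^2 at the complex points \<alpha> + i \<beta>
  and \<alpha> - i \<beta>. The obstacle is the singularity: P vanishes at x = i, on the boundary of
  the disc, and a Bochner integral is 0 by default when the integrand is not integrable, so
  integrability has to accompany every value. Since |P| \<le> 2^n on the sphere, the proof
  integrates the nonnegative function ln (4^n) - ln |P|^2, where iterated integrals need no prior
  integrability, and subtracts only at the end. For the same reason the auxiliary integrals come in
  pairs: a nonnegative one with an explicit antiderivative or a Tonelli argument, then signed ones
  by integration by parts. The diameter \<alpha> = 0, whose upper end value is 0, is a null set, and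
  the two halves of the disc are mirror images.\<close>

lemma lborel_complex: "distr (lborel :: (real \<times> real) measure) borel (\<lambda>(x, y). Complex x y) = lborel"
proof (rule lborel_eqI[symmetric])
  fix l u :: complex
  assume le: "\<And>b. b \<in> Basis \<Longrightarrow> l \<bullet> b \<le> u \<bullet> b"
  have m [measurable]: "(\<lambda>(x, y). Complex x y) \<in> borel_measurable (borel :: (real \<times> real) measure)"
    unfolding Complex_eq by (auto simp: case_prod_beta intro!: borel_measurable_continuous_onI continuous_intros)
  have 1: "(\<lambda>(x, y). Complex x y) -` box l u = box (Re l, Im l) (Re u, Im u)"
    by (auto simp: box_def Basis_complex_def Basis_prod_def)
  have 2: "box (Re l, Im l) (Re u, Im u) = {Re l<..<Re u} \<times> {Im l<..<Im u}"
    by (auto simp: box_def Basis_prod_def)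
  have 3: "emeasure lborel (box (Re l, Im l) (Re u, Im u)) =
      emeasure lborel {Re l<..<Re u} * emeasure lborel {Im l<..<Im u}"
    unfolding 2 lborel_prod[symmetric] by (rule lborel.emeasure_pair_measure_Times) simp_all
  have "Re l \<le> Re u" "Im l \<le> Im u" using le[of 1] le[of \<i>] by (auto simp: Basis_complex_def)
  then show "emeasure (distr lborel borel (\<lambda>(x, y). Complex x y)) (box l u) = (\<Prod>b\<in>Basis. (u - l) \<bullet> b)"
    by (simp add: emeasure_distr 1 3 ennreal_mult Basis_complex_def complex_i_not_one)
qed simp

lemma nn_integral_lborel_complex:
  assumes "f \<in> borel_measurable (borel :: complex measure)"
  shows "(\<integral>\<^sup>+z. f z \<partial>lborel) = (\<integral>\<^sup>+x. \<integral>\<^sup>+y. f (Complex x y) \<partial>lborel \<partial>lborel)"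
proof -
  have m [measurable]: "(\<lambda>(x, y). Complex x y) \<in> borel_measurable (borel :: (real \<times> real) measure)"
    unfolding Complex_eq by (auto simp: case_prod_beta intro!: borel_measurable_continuous_onI continuous_intros)
  note assms [measurable]
  have "(\<integral>\<^sup>+z. f z \<partial>lborel) = (\<integral>\<^sup>+z. f z \<partial>distr (lborel :: (real \<times> real) measure) borel (\<lambda>(x, y). Complex x y))"
    by (simp only: lborel_complex)
  also have "\<dots> = (\<integral>\<^sup>+p. f (case p of (x, y) \<Rightarrow> Complex x y) \<partial>(lborel \<Otimes>\<^sub>M lborel))"
    by (subst nn_integral_distr) (auto simp: lborel_prod)
  also have "\<dots> = (\<integral>\<^sup>+x. \<integral>\<^sup>+y. f (Complex x y) \<partial>lborel \<partial>lborel)"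
    by (subst lborel.nn_integral_fst[symmetric]) (auto simp: lborel_prod)
  finally show ?thesis .
qed

lemma nn_integral_ident_interval:
  fixes c w :: real
  assumes "0 \<le> c" "c \<le> w"
  shows "(\<integral>\<^sup>+t. ennreal (2 * pi * t) * indicator {c..w} t \<partial>lborel) = ennreal (pi * (w\<^sup>2 - c\<^sup>2))"
proof -
  have "(\<integral>\<^sup>+t. ennreal (2 * pi * t) * indicator {c..w} t \<partial>lborel) = ennreal (pi * w\<^sup>2 - pi * c\<^sup>2)"
    using assms
    by (intro nn_integral_FTC_Icc) (auto intro!: derivative_eq_intros)
  then show ?thesis by (simp add: algebra_simps)
qed

text \<open>A sublevel set at height \<open>w\<close> is a disc of squared radius w^2 - c^2, of area
  \<pi>(w^2 - c^2), whose derivative 2 \<pi> w is independent of \<open>c\<close>. Hence, with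
  \<open>c\<close> the modulus of the first coordinate, |x| has the same density for every first
  coordinate; only its support starts at \<open>c\<close>. This is specific to a two-dimensional
  second coordinate.\<close>

lemma distr_sqrt_norm_complex:
  fixes c :: real
  assumes c: "0 \<le> c"
  shows "distr (lborel :: complex measure) borel (\<lambda>b. sqrt (c\<^sup>2 + (norm b)\<^sup>2)) =
         density lborel (\<lambda>w. ennreal (2 * pi * w) * indicator {c..} w)"
    (is "?M = ?N")
proof -
  have M: "emeasure ?M {..w} = (if c \<le> w then ennreal (pi * (w\<^sup>2 - c\<^sup>2)) else 0)" for w
  proof (cases "c \<le> w")
    case True
    have "(\<lambda>b::complex. sqrt (c\<^sup>2 + (norm b)\<^sup>2)) -` {..w} = cball 0 (sqrt (w\<^sup>2 - c\<^sup>2))"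
    proof (rule set_eqI)
      fix b :: complex
      have "sqrt (c\<^sup>2 + (norm b)\<^sup>2) \<le> w \<longleftrightarrow> sqrt (c\<^sup>2 + (norm b)\<^sup>2) \<le> sqrt (w\<^sup>2)"
        using True c by simp
      also have "\<dots> \<longleftrightarrow> sqrt ((norm b)\<^sup>2) \<le> sqrt (w\<^sup>2 - c\<^sup>2)"
        unfolding real_sqrt_le_iff by linarith
      finally show "b \<in> (\<lambda>b::complex. sqrt (c\<^sup>2 + (norm b)\<^sup>2)) -` {..w} \<longleftrightarrow> b \<in> cball 0 (sqrt (w\<^sup>2 - c\<^sup>2))"
        by simp
    qed
    moreover have "c\<^sup>2 \<le> w\<^sup>2" using True c by (simp add: power_mono)
    ultimately show ?thesis
      using True by (subst emeasure_distr) (simp_all add: emeasure_cball unit_ball_vol_2)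
  next
    case False
    have "w < sqrt (c\<^sup>2 + (norm b)\<^sup>2)" for b :: complex
      using False c by (smt (verit) real_le_rsqrt zero_le_power2)
    then have "(\<lambda>b::complex. sqrt (c\<^sup>2 + (norm b)\<^sup>2)) -` {..w} = {}"
      by (simp add: set_eq_iff not_le)
    then show ?thesis using False by (subst emeasure_distr) simp_all
  qed
  have N: "emeasure ?N {..w} = (if c \<le> w then ennreal (pi * (w\<^sup>2 - c\<^sup>2)) else 0)" for w
  proof -
    have "emeasure ?N {..w} = (\<integral>\<^sup>+t. ennreal (2 * pi * t) * indicator {c..w} t \<partial>lborel)"
      by (subst emeasure_density) (auto intro!: nn_integral_cong split: split_indicator)
    also have "\<dots> = (if c \<le> w then ennreal (pi * (w\<^sup>2 - c\<^sup>2)) else 0)"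
      using c by (auto simp: nn_integral_ident_interval)
    finally show ?thesis .
  qed
  show ?thesis
  proof (rule measure_eqI_generator_eq[where E = "range atMost" and \<Omega> = UNIV and A = "\<lambda>i. {..real i}"])
    show "Int_stable (range (atMost :: real \<Rightarrow> _))"
    proof (rule Int_stableI_image)
      fix i j :: real
      have "{..i} \<inter> {..j} = {..min i j}" by (auto simp: min_def)
      then show "\<exists>k\<in>UNIV. {..i} \<inter> {..j} = {..k}" by blast
    qed
    show "emeasure ?M X = emeasure ?N X" if "X \<in> range atMost" for X
    proof -
      from that obtain w where "X = {..w}" by blast
      then show ?thesis by (simp only: M N)
    qed
    show "sets ?M = sigma_sets UNIV (range atMost)" "sets ?N = sigma_sets UNIV (range atMost)"
      by (simp_all add: borel_eq_atMost)
    show "(\<Union>i. {..real i}) = UNIV" using real_arch_simple by auto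
    show "emeasure ?M {..real i} \<noteq> \<infinity>" for i by (simp add: M)
  qed auto
qed

lemma nn_integral_scaleR_complex:
  fixes g :: "complex \<Rightarrow> ennreal"
  assumes [measurable]: "g \<in> borel_measurable borel" and w: "0 < w"
  shows "(\<integral>\<^sup>+a. g (a /\<^sub>R w) \<partial>lborel) = ennreal (w\<^sup>2) * (\<integral>\<^sup>+a. g a \<partial>lborel)"
proof -
  have "(\<integral>\<^sup>+a. g (a /\<^sub>R w) \<partial>lborel) =
      (\<integral>\<^sup>+a. g (a /\<^sub>R w) \<partial>density (distr lborel borel (\<lambda>x. 0 + w *\<^sub>R x)) (\<lambda>_. ennreal (\<bar>w\<bar> ^ DIM(complex))))"
    using w by (subst lborel_affine[of w 0, symmetric]) simp_all
  also have "\<dots> = (\<integral>\<^sup>+a. ennreal (w\<^sup>2) * g a \<partial>lborel)"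
    using w by (simp add: nn_integral_density nn_integral_distr)
  finally show ?thesis by (simp add: nn_integral_cmult)
qed

text \<open>Integrating out the second coordinate first, in the variable \<open>w = |x|\<close>, turns the radial
  projection into a mere rescaling of the first coordinate.\<close>

lemma nn_integral_ball_radial_fst:
  fixes g :: "complex \<Rightarrow> ennreal"
  assumes g [measurable]: "g \<in> borel_measurable borel"
  shows "(\<integral>\<^sup>+x. indicator (ball 0 1) x * g (fst x /\<^sub>R norm x) \<partial>(lborel :: (complex \<times> complex) measure)) =
         ennreal (pi / 2) * (\<integral>\<^sup>+a. indicator (ball 0 1) a * g a \<partial>lborel)"
proof -
  \<comment> \<open>The modulus |x| becomes a variable \<open>w\<close> independent of
    \<open>a\<close>: the unit ball is the condition \<open>w < 1\<close>, while
    \<open>norm a \<le> w\<close> enters later through the density of |x|.\<close>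
  define F where "F a w = (indicator {..<1} w * g (a /\<^sub>R w) :: ennreal)" for a :: complex and w :: real
  have g1: "(\<lambda>a. indicator (cball 0 1) a * g a) \<in> borel_measurable borel"
    by (intro borel_measurable_times_ennreal borel_measurable_indicator g) simp
  have [measurable]: "case_prod F \<in> borel_measurable (borel \<Otimes>\<^sub>M borel)"
    unfolding F_def by (measurable)
  have [measurable]: "(fst :: complex \<times> complex \<Rightarrow> complex) \<in> borel_measurable borel"
    by (intro borel_measurable_continuous_onI continuous_intros)
  have "(\<lambda>x :: complex \<times> complex. case_prod F (fst x, norm x)) \<in> borel_measurable borel"
    by measurable
  then have m: "(\<lambda>x. F (fst x) (norm x)) \<in> borel_measurable ((lborel :: complex measure) \<Otimes>\<^sub>M (lborel :: complex measure))"
    by (simp add: lborel_prod)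
  have "(\<integral>\<^sup>+x. indicator (ball 0 1) x * g (fst x /\<^sub>R norm x) \<partial>(lborel :: (complex \<times> complex) measure)) =
      (\<integral>\<^sup>+x. F (fst x) (norm x) \<partial>(lborel :: (complex \<times> complex) measure))"
    unfolding F_def by (intro nn_integral_cong) (auto split: split_indicator)
  also have "\<dots> = (\<integral>\<^sup>+x. F (fst x) (norm x) \<partial>((lborel :: complex measure) \<Otimes>\<^sub>M (lborel :: complex measure)))"
    by (simp only: lborel_prod)
  also have "\<dots> = (\<integral>\<^sup>+a. \<integral>\<^sup>+b. F a (sqrt ((norm a)\<^sup>2 + (norm b)\<^sup>2)) \<partial>(lborel :: complex measure) \<partial>lborel)"
    by (subst lborel.nn_integral_fst[OF m, symmetric]) (simp add: norm_Pair)
  also have "\<dots> = (\<integral>\<^sup>+a. \<integral>\<^sup>+w. ennreal (2 * pi * w) * indicator {norm a..} w * F a w \<partial>lborel \<partial>lborel)"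
  proof (intro nn_integral_cong)
    fix a :: complex
    have "(\<integral>\<^sup>+b. F a (sqrt ((norm a)\<^sup>2 + (norm b)\<^sup>2)) \<partial>(lborel :: complex measure)) =
        (\<integral>\<^sup>+w. F a w \<partial>distr (lborel :: complex measure) borel (\<lambda>b. sqrt ((norm a)\<^sup>2 + (norm b)\<^sup>2)))"
      by (subst nn_integral_distr) simp_all
    also have "\<dots> = (\<integral>\<^sup>+w. ennreal (2 * pi * w) * indicator {norm a..} w * F a w \<partial>lborel)"
      by (subst distr_sqrt_norm_complex) (simp_all add: nn_integral_density)
    finally show "(\<integral>\<^sup>+b. F a (sqrt ((norm a)\<^sup>2 + (norm b)\<^sup>2)) \<partial>(lborel :: complex measure)) = \<dots>" .
  qed
  also have "\<dots> = (\<integral>\<^sup>+w. \<integral>\<^sup>+a. ennreal (2 * pi * w) * indicator {norm a..} w * F a w \<partial>lborel \<partial>lborel)"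
  proof (rule lborel_pair.Fubini')
    have "(\<lambda>(w, a). ennreal (2 * pi * w) * indicator {norm a..} w * F a w) =
        (\<lambda>(w, a). if norm a \<le> w then ennreal (2 * pi * w) * F a w else 0)"
      by (auto simp: fun_eq_iff)
    also have "\<dots> \<in> borel_measurable (lborel \<Otimes>\<^sub>M lborel)"
      by measurable
    finally show "(\<lambda>(w, a). ennreal (2 * pi * w) * indicator {norm a..} w * F a w)
        \<in> borel_measurable (lborel \<Otimes>\<^sub>M lborel)" .
  qed
  \<comment> \<open>With \<open>w\<close> outermost, the inner integral runs over the disc of radius
    \<open>w\<close>; rescaling it to the unit disc costs a factor w^2, which turns 2 \<pi> w into 2
    \<pi> w^3. Its integral over the unit interval is the constant \<pi>/2.\<close>
  also have "\<dots> = (\<integral>\<^sup>+w. ennreal (2 * pi * w ^ 3) * indicator {0..1} w *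
       (\<integral>\<^sup>+a. indicator (cball 0 1) a * g a \<partial>lborel) \<partial>lborel)"
  proof (intro nn_integral_cong_AE)
    \<comment> \<open>At 0 the scaling degenerates, and at 1 the strict bound in \<open>F\<close>
      disagrees with the closed interval on the right.\<close>
    have "AE w in lborel. w \<noteq> 0 \<and> w \<noteq> (1::real)"
      by (intro AE_conjI AE_lborel_singleton)
    then show "AE w in lborel. (\<integral>\<^sup>+a. ennreal (2 * pi * w) * indicator {norm a..} w * F a w \<partial>lborel) =
       ennreal (2 * pi * w ^ 3) * indicator {0..1} w * (\<integral>\<^sup>+a. indicator (cball 0 1) a * g a \<partial>lborel)"
    proof eventually_elim
      case (elim w)
      show ?case
      proof (cases "0 < w \<and> w < 1")
        case True
        have "(\<integral>\<^sup>+a. ennreal (2 * pi * w) * indicator {norm a..} w * F a w \<partial>lborel) =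
            (\<integral>\<^sup>+a. ennreal (2 * pi * w) * (indicator (cball 0 1) (a /\<^sub>R w) * g (a /\<^sub>R w)) \<partial>lborel)"
          using True by (intro nn_integral_cong) (auto simp: F_def field_simps split: split_indicator)
        also have "\<dots> = ennreal (2 * pi * w) * (ennreal (w\<^sup>2) * (\<integral>\<^sup>+a. indicator (cball 0 1) a * g a \<partial>lborel))"
          using True nn_integral_scaleR_complex[OF g1] measurable_compose[OF _ g1, of "\<lambda>a. a /\<^sub>R w" lborel]
          by (subst nn_integral_cmult) simp_all
        finally show ?thesis
          using True by (simp add: ennreal_mult[symmetric] mult.assoc[symmetric] power3_eq_cube power2_eq_square)
      next
        case False
        have "ennreal (2 * pi * w) * indicator {norm a..} w * F a w = 0" for a
        proof (cases "norm a \<le> w")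
          case True
          with False elim have "1 < w" using norm_ge_zero[of a] by linarith
          then show ?thesis by (simp add: F_def)
        qed simp
        then have "(\<integral>\<^sup>+a. ennreal (2 * pi * w) * indicator {norm a..} w * F a w \<partial>lborel) = 0"
          by (simp only: nn_integral_const) simp
        then show ?thesis using False elim by (auto split: split_indicator)
      qed
    qed
  qed
  also have "\<dots> = (\<integral>\<^sup>+w. ennreal (2 * pi * w ^ 3) * indicator {0..1} w \<partial>lborel) *
       (\<integral>\<^sup>+a. indicator (cball 0 1) a * g a \<partial>lborel)"
    by (rule nn_integral_multc) simp
  also have "(\<integral>\<^sup>+w. ennreal (2 * pi * w ^ 3) * indicator {0..1} w \<partial>lborel) = ennreal (pi / 2 * 1 ^ 4 - pi / 2 * 0 ^ 4)"
    by (intro nn_integral_FTC_Icc) (auto intro!: derivative_eq_intros)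
  \<comment> \<open>The closed disc came from \<open>norm a \<le> w\<close>; the circle is
    negligible.\<close>
  also have "(\<integral>\<^sup>+a. indicator (cball 0 1) a * g a \<partial>lborel) = (\<integral>\<^sup>+a. indicator (ball 0 1) a * g a \<partial>lborel)"
  proof (intro nn_integral_cong_AE)
    have "AE a in lborel. a \<notin> sphere (0::complex) 1"
      using negligible_sphere[of "0::complex" 1]
      by (intro AE_not_in) (simp add: negligible_iff_null_sets null_sets_completion_iff)
    then show "AE a in lborel. indicator (cball 0 1) a * g a = indicator (ball 0 1) a * g a"
      by eventually_elim (auto split: split_indicator)
  qed
  finally show ?thesis by simp
qed

text \<open>A four-dimensional form of Archimedes' hat-box theorem. The unit balls of dimension 4
  and 2 have volumes \<pi>^2/2 and \<pi>, so the factor \<pi>/2 of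
  \<open>nn_integral_ball_radial_fst\<close> is exactly what the two normalizations absorb.\<close>

lemma distr_haar_S3_fst: "distr haar_S3 borel fst = uniform_measure lborel (ball 0 1)"
proof (rule measure_eqI)
  fix A :: "complex set"
  assume "A \<in> sets (distr haar_S3 borel fst)"
  then have A [measurable]: "A \<in> sets borel" by simp
  have p [measurable]: "(\<lambda>x::quat. x /\<^sub>R norm x) \<in> borel_measurable borel" by measurable
  have f [measurable]: "(fst :: quat \<Rightarrow> complex) \<in> borel_measurable borel"
    by (intro borel_measurable_continuous_onI continuous_intros)
  have E: "emeasure lborel {x\<in>ball (0::quat) 1. fst x /\<^sub>R norm x \<in> B} = ennreal (pi / 2) * emeasure lborel (ball 0 1 \<inter> B)"
    if B [measurable]: "B \<in> sets borel" for B :: "complex set"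
  proof -
    have m: "{x\<in>ball (0::quat) 1. fst x /\<^sub>R norm x \<in> B} \<in> sets borel" by measurable
    have "emeasure lborel {x\<in>ball (0::quat) 1. fst x /\<^sub>R norm x \<in> B} =
        (\<integral>\<^sup>+x. indicator {x\<in>ball (0::quat) 1. fst x /\<^sub>R norm x \<in> B} x \<partial>lborel)"
      using m by simp
    also have "\<dots> = (\<integral>\<^sup>+x. indicator (ball 0 1) x * indicator B (fst x /\<^sub>R norm x) \<partial>(lborel :: quat measure))"
      by (intro nn_integral_cong) (auto split: split_indicator)
    also have "\<dots> = ennreal (pi / 2) * (\<integral>\<^sup>+a. indicator (ball 0 1) a * indicator B a \<partial>lborel)"
      by (rule nn_integral_ball_radial_fst) simp
    also have "(\<integral>\<^sup>+a. indicator (ball 0 1) a * indicator B a \<partial>lborel) =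
        (\<integral>\<^sup>+a. indicator (ball 0 1 \<inter> B) a \<partial>lborel)"
      by (intro nn_integral_cong) (auto split: split_indicator)
    also have "\<dots> = emeasure lborel (ball 0 1 \<inter> B)"
      by simp
    finally show ?thesis .
  qed
  have "emeasure (distr haar_S3 borel fst) A = emeasure (uniform_measure lborel (ball 0 1)) {x::quat. fst x /\<^sub>R norm x \<in> A}"
    unfolding haar_S3_def by (subst distr_distr) (simp_all add: emeasure_distr vimage_def comp_def)
  also have "\<dots> = emeasure lborel {x\<in>ball (0::quat) 1. fst x /\<^sub>R norm x \<in> A} / emeasure lborel (ball (0::quat) 1)"
    by (subst emeasure_uniform_measure) (simp_all add: Int_def)
  also have "\<dots> = emeasure lborel (ball 0 1 \<inter> A) / emeasure lborel (ball (0::complex) 1)"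
  proof -
    have "emeasure lborel (ball (0::complex) 1 \<inter> A) \<le> emeasure lborel (ball (0::complex) 1)"
      by (intro emeasure_mono) auto
    also have "\<dots> < \<infinity>" by (simp add: emeasure_ball)
    finally obtain r where r: "emeasure lborel (ball (0::complex) 1 \<inter> A) = ennreal r" "0 \<le> r"
      by (cases "emeasure lborel (ball (0::complex) 1 \<inter> A)") auto
    show ?thesis
      unfolding E[OF A] r(1)
      using r(2) by (simp add: emeasure_ball unit_ball_vol_2 unit_ball_vol_4 ennreal_mult'[symmetric]
          divide_ennreal power2_eq_square)
  qed
  finally show "emeasure (distr haar_S3 borel fst) A = emeasure (uniform_measure lborel (ball 0 1)) A"
    by simp
qed simp

lemma AE_haar_S3_norm: "AE x in haar_S3. norm x = 1"
proof -
  have p [measurable]: "(\<lambda>x::quat. x /\<^sub>R norm x) \<in> borel_measurable borel" by measurable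
  have "AE x in uniform_measure lborel (ball (0::quat) 1). norm (x /\<^sub>R norm x) = 1"
  proof (rule AE_uniform_measureI)
    show "AE x in lborel. x \<in> ball (0::quat) 1 \<longrightarrow> norm (x /\<^sub>R norm x) = 1"
      using AE_lborel_singleton[of "0::quat"] by eventually_elim simp
  qed simp
  then show ?thesis
    unfolding haar_S3_def by (subst AE_distr_iff) simp_all
qed

section \<open>The modulus of the star powers on the unit sphere\<close>

lemma qmult_complex_right: "qmult p (c, 0) = (fst p * c, snd p * cnj c)"
  by (simp add: qmult_def)

lemma qmult_zero_right: "qmult p 0 = 0"
  by (simp add: qmult_def zero_prod_def)

text \<open>The coefficients are complex and commute with one another, so the star product acts as
  in the commutative ring of polynomials and the binomial theorem holds. For l > n the truncated
  exponent is harmless, the binomial coefficient being 0.\<close>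

lemma star_pow_x_minus_i:
  "star_pow x_minus_i n l = (of_nat (n choose l) * (- \<i>) ^ (n - l), 0)"
proof (induction n arbitrary: l)
  case 0
  then show ?case by (cases l) (auto simp: sr_one_def qone_def zero_prod_def)
next
  case (Suc n)
  let ?c = "\<lambda>m k. (of_nat (m choose k) * (- \<i>) ^ (m - k), 0) :: quat"
  have "star_pow x_minus_i (Suc n) l = (\<Sum>k\<in>{0..l}. qmult (?c n k) (x_minus_i (l - k)))"
    by (simp add: star_prod_def Suc.IH)
  also have "\<dots> = ?c (Suc n) l"
  proof (cases l)
    case 0
    then show ?thesis by (simp add: x_minus_i_def qmult_def qi_def)
  next
    case (Suc m)
    \<comment> \<open>The factor x - i has coefficients only in degrees 0 and 1, so two terms
      survive and combine by Pascal's rule.\<close>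
    have "(\<Sum>k\<in>{0..l}. qmult (?c n k) (x_minus_i (l - k))) =
        (\<Sum>k\<in>{m, Suc m}. qmult (?c n k) (x_minus_i (l - k)))"
      by (rule sum.mono_neutral_right) (auto simp: Suc x_minus_i_def qmult_zero_right)
    also have "\<dots> = (of_nat (n choose m) * (- \<i>) ^ (n - m) + of_nat (n choose Suc m) * (- \<i>) ^ (n - Suc m) * (- \<i>), 0)"
      by (simp add: Suc x_minus_i_def qi_def qone_def qmult_complex_right del: minus_mult_right)
    also have "of_nat (n choose Suc m) * (- \<i>) ^ (n - Suc m) * (- \<i>) = of_nat (n choose Suc m) * (- \<i>) ^ (n - m)"
    proof (cases "m < n")
      case True
      then have "n - m = Suc (n - Suc m)" by simp
      then show ?thesis by (simp only: power_Suc mult_ac)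
    qed (simp add: binomial_eq_0)
    finally show ?thesis by (simp add: Suc algebra_simps)
  qed
  finally show ?case .
qed

lemma sr_eval_star_pow:
  "sr_eval (star_pow x_minus_i n) x = (\<Sum>l\<le>n. qmult (qpow x l) (of_nat (n choose l) * (- \<i>) ^ (n - l), 0))"
proof -
  have "{l. star_pow x_minus_i n l \<noteq> 0} = {..n}"
    by (auto simp: star_pow_x_minus_i zero_prod_def)
  then show ?thesis by (simp add: sr_eval_def star_pow_x_minus_i)
qed

text \<open>On the unit sphere, every power of \<open>x = \<alpha> + J \<beta>\<close> lies in the plane spanned by \<open>1\<close> and \<open>J\<close>.\<close>

lemma qpow_unit:
  fixes x :: quat and \<beta> :: real
  assumes x: "norm x = 1" and \<beta>: "\<beta> = sqrt (1 - (Re (fst x))\<^sup>2)" "\<beta> > 0"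
  defines "z \<equiv> Complex (Re (fst x)) \<beta>"
  shows "qpow x l = (of_real (Re (z ^ l)) + \<i> * of_real (Im (z ^ l) * Im (fst x) / \<beta>),
                     of_real (Im (z ^ l) / \<beta>) * snd x)"
proof (induction l)
  case 0
  show ?case by (simp add: qone_def)
next
  case (Suc l)
  obtain a b where ab: "x = (a, b)" by (cases x)
  have "(norm b)\<^sup>2 = 1 - (Re a)\<^sup>2 - (Im a)\<^sup>2"
    using x by (simp add: ab norm_Pair cmod_power2[of a])
  moreover have "0 < 1 - (Re a)\<^sup>2" using \<beta> ab by (simp add: real_sqrt_gt_0_iff)
  then have "\<beta> * \<beta> = 1 - (Re a)\<^sup>2" using \<beta> by (simp add: ab)
  ultimately have b: "b * cnj b = of_real (\<beta> * \<beta> - (Im a)\<^sup>2)"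
    by (metis complex_norm_square)
  define u v where "u = Re (z ^ l)" and "v = Im (z ^ l)"
  have uv: "Re (z ^ Suc l) = Re a * u - \<beta> * v" "Im (z ^ Suc l) = Re a * v + \<beta> * u"
    by (simp_all add: u_def v_def z_def ab)
  have "(of_real u + \<i> * of_real (v * Im a / \<beta>)) * a - of_real (v / \<beta>) * b * cnj b =
      of_real (Re (z ^ Suc l)) + \<i> * of_real (Im (z ^ Suc l) * Im a / \<beta>)"
    unfolding uv mult.assoc[of _ b] b using \<beta>(2)
    by (auto simp: complex_eq_iff field_simps power2_eq_square)
  moreover have "(of_real u + \<i> * of_real (v * Im a / \<beta>)) * b + of_real (v / \<beta>) * b * cnj a =
      of_real (Im (z ^ Suc l) / \<beta>) * b"
    unfolding uv using \<beta>(2) by (auto simp: complex_eq_iff field_simps)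
  ultimately show ?case
    using Suc.IH by (simp add: ab qmult_def u_def v_def)
qed

text \<open>The variance identity for weights \<lambda> = (1 + s)/2 and 1 - \<lambda>, whose product
  is (1 - s^2)/4. The correction term is what the second quaternion coordinate contributes, so the
  total becomes linear in s.\<close>

lemma norm_convex_combination_sq:
  fixes A B :: complex and s :: real
  shows "(norm (of_real ((1 + s) / 2) * A + of_real ((1 - s) / 2) * B))\<^sup>2 + (1 - s\<^sup>2) / 4 * (norm (A - B))\<^sup>2 =
         (1 + s) / 2 * (norm A)\<^sup>2 + (1 - s) / 2 * (norm B)\<^sup>2"
  by (simp add: cmod_power2) (simp add: field_simps power2_eq_square)

text \<open>With z = \<alpha> + i \<beta>, \<open>A\<close> and \<open>B\<close> are the values of P
  at z and its conjugate. The first coordinate of P(x) is their weighted mean; the second has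
  modulus |A - B| |snd x| / (2 \<beta>), and |snd x|^2 / \<beta>^2 = 1 - s^2 on the sphere, so the
  variance identity applies. As |z| = 1, the squared distances of z and its conjugate from i are 2 -
  2 \<beta> and 2 + 2 \<beta>.\<close>

lemma norm_sr_eval_star_pow:
  fixes x :: quat and \<beta> :: real
  assumes x: "norm x = 1" and \<beta>: "\<beta> = sqrt (1 - (Re (fst x))\<^sup>2)" "\<beta> > 0"
  shows "(norm (sr_eval (star_pow x_minus_i n) x))\<^sup>2 =
     (1 + Im (fst x) / \<beta>) / 2 * (2 - 2 * \<beta>) ^ n + (1 - Im (fst x) / \<beta>) / 2 * (2 + 2 * \<beta>) ^ n"
proof -
  define z where "z = Complex (Re (fst x)) \<beta>"
  define s where "s = Im (fst x) / \<beta>"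
  define c where "c l = of_nat (n choose l) * (- \<i>) ^ (n - l)" for l
  define A where "A = (z - \<i>) ^ n"
  define B where "B = (cnj z - \<i>) ^ n"
  have A: "A = (\<Sum>l\<le>n. c l * z ^ l)"
    using binomial_ring[of z "- \<i>" n] by (simp add: A_def c_def mult_ac)
  have B: "B = (\<Sum>l\<le>n. c l * cnj (z ^ l))"
    using binomial_ring[of "cnj z" "- \<i>" n] by (simp add: B_def c_def mult_ac)
  \<comment> \<open>The second coordinate is written with an outer conjugate because right
    multiplication by a complex \<open>c\<close> multiplies it by \<open>cnj c\<close>; the
    coefficients then pass inside and the sums assemble to \<open>B - A\<close>.\<close>
  have q: "qpow x l = (of_real ((1 + s) / 2) * z ^ l + of_real ((1 - s) / 2) * cnj (z ^ l),
      (of_real (1 / \<beta>) * snd x) * cnj ((cnj (z ^ l) - z ^ l) * (\<i> / 2)))" for l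
  proof -
    have "(of_real (Re w) + \<i> * of_real (Im w * Im (fst x) / \<beta>), of_real (Im w / \<beta>) * snd x) =
        (of_real ((1 + s) / 2) * w + of_real ((1 - s) / 2) * cnj w,
         (of_real (1 / \<beta>) * snd x) * cnj ((cnj w - w) * (\<i> / 2)))" for w
      by (auto simp: complex_eq_iff s_def field_simps)
    then show ?thesis
      unfolding qpow_unit[OF assms] z_def[symmetric] by blast
  qed
  have "sr_eval (star_pow x_minus_i n) x = (\<Sum>l\<le>n. qmult (qpow x l) (c l, 0))"
    by (simp add: sr_eval_star_pow c_def)
  also have "\<dots> = (\<Sum>l\<le>n. (of_real ((1 + s) / 2) * (c l * z ^ l) + of_real ((1 - s) / 2) * (c l * cnj (z ^ l)),
      (of_real (1 / \<beta>) * snd x) * cnj (\<i> / 2 * (c l * cnj (z ^ l) - c l * z ^ l))))"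
    unfolding q qmult_complex_right by (intro sum.cong) (simp_all add: algebra_simps)
  also have "\<dots> = (of_real ((1 + s) / 2) * A + of_real ((1 - s) / 2) * B,
      (of_real (1 / \<beta>) * snd x) * cnj (\<i> / 2 * (B - A)))"
    unfolding A B sum_prod
    by (simp only: sum.distrib sum_distrib_left[symmetric] cnj_sum[symmetric] sum_subtractf)
  finally have "(norm (sr_eval (star_pow x_minus_i n) x))\<^sup>2 =
      (norm (of_real ((1 + s) / 2) * A + of_real ((1 - s) / 2) * B))\<^sup>2 + (norm (snd x) / \<beta>)\<^sup>2 / 4 * (norm (A - B))\<^sup>2"
    using \<beta>(2) by (simp add: norm_Pair norm_mult norm_divide power_mult_distrib power_divide norm_minus_commute
        complex_cnj_diff[symmetric] del: complex_cnj_diff)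
  also have "(norm (snd x) / \<beta>)\<^sup>2 = 1 - s\<^sup>2"
  proof -
    obtain a b where ab: "x = (a, b)" by (cases x)
    have 1: "(Re a)\<^sup>2 + (Im a)\<^sup>2 + (norm b)\<^sup>2 = 1"
      using x by (simp add: ab norm_Pair cmod_power2)
    have "0 < 1 - (Re a)\<^sup>2" using \<beta> ab by (simp add: real_sqrt_gt_0_iff)
    then have "\<beta>\<^sup>2 = 1 - (Re a)\<^sup>2" using \<beta> by (simp add: ab)
    then show ?thesis using 1 \<beta>(2) by (simp add: ab s_def power_divide field_simps)
  qed
  also note norm_convex_combination_sq
  also have "(norm A)\<^sup>2 = (2 - 2 * \<beta>) ^ n"
  proof -
    have "0 < 1 - (Re (fst x))\<^sup>2" using \<beta> by (simp add: real_sqrt_gt_0_iff)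
    then have "\<beta>\<^sup>2 = 1 - (Re (fst x))\<^sup>2" using \<beta> by simp
    then have "(norm (z - \<i>))\<^sup>2 = 2 - 2 * \<beta>"
      by (simp add: cmod_power2 z_def) (simp add: power2_eq_square algebra_simps)
    then show ?thesis by (simp add: A_def norm_power power_mult[symmetric] mult.commute[of n]) (simp add: power_mult)
  qed
  also have "(norm B)\<^sup>2 = (2 + 2 * \<beta>) ^ n"
  proof -
    have "0 < 1 - (Re (fst x))\<^sup>2" using \<beta> by (simp add: real_sqrt_gt_0_iff)
    then have "\<beta>\<^sup>2 = 1 - (Re (fst x))\<^sup>2" using \<beta> by simp
    then have "(norm (cnj z - \<i>))\<^sup>2 = 2 + 2 * \<beta>"
      by (simp add: cmod_power2 z_def) (simp add: power2_eq_square algebra_simps)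
    then show ?thesis by (simp add: B_def norm_power power_mult[symmetric] mult.commute[of n]) (simp add: power_mult)
  qed
  finally show ?thesis by (simp add: s_def)
qed

lemma continuous_on_qmult [continuous_intros]:
  assumes "continuous_on S f" "continuous_on S g"
  shows "continuous_on S (\<lambda>x. qmult (f x) (g x))"
  unfolding qmult_def by (intro continuous_intros assms)

lemma continuous_on_qpow: "continuous_on S (\<lambda>x. qpow x l)"
  by (induction l) (auto intro!: continuous_intros)

lemma borel_measurable_sr_eval [measurable]: "sr_eval a \<in> borel_measurable borel"
  unfolding sr_eval_def
  by (intro borel_measurable_continuous_onI continuous_intros continuous_on_qpow)

section \<open>Integrals of hyperbolic functions\<close>

lemma set_integral_FTC_pos_nonneg:
  fixes f F :: "real \<Rightarrow> real"
  assumes F: "\<And>t. 0 < t \<Longrightarrow> (F has_real_derivative f t) (at t)"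
    and f: "\<And>t. 0 < t \<Longrightarrow> isCont f t"
    and nonneg: "\<And>t. 0 < t \<Longrightarrow> 0 \<le> f t"
    and A: "(F \<longlongrightarrow> A) (at_right 0)" and B: "(F \<longlongrightarrow> B) at_top"
  shows "set_integrable lborel {0<..} f" "(LBINT t:{0<..}. f t) = B - A"
proof -
  have e: "einterval 0 \<infinity> = {0<..}" by (auto simp: einterval_def)
  have A': "((F \<circ> real_of_ereal) \<longlongrightarrow> A) (at_right 0)"
    using A unfolding zero_ereal_def by (simp add: ereal_tendsto_simps)
  have B': "((F \<circ> real_of_ereal) \<longlongrightarrow> B) (at_left \<infinity>)"
    using B by (simp add: ereal_tendsto_simps)
  note FTC = interval_integral_FTC_nonneg[of 0 \<infinity> F f, OF _ _ _ _ A' B']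
  show "set_integrable lborel {0<..} f"
    unfolding e[symmetric] by (rule FTC(1)) (use F f nonneg in auto)
  have "(LBINT t=0..\<infinity>. f t) = B - A"
    by (rule FTC(2)) (use F f nonneg in auto)
  then show "(LBINT t:{0<..}. f t) = B - A"
    by (simp add: interval_lebesgue_integral_0_infty)
qed

text \<open>For a signed integrand, limits of the antiderivative do not give integrability, which is
  therefore a hypothesis. This version serves the integrations by parts, where the integrand is a
  difference of integrable terms.\<close>

lemma set_integral_FTC_pos:
  fixes f F :: "real \<Rightarrow> real"
  assumes F: "\<And>t. 0 < t \<Longrightarrow> (F has_real_derivative f t) (at t)"
    and f: "\<And>t. 0 < t \<Longrightarrow> isCont f t"
    and int: "set_integrable lborel {0<..} f"
    and A: "(F \<longlongrightarrow> A) (at_right 0)" and B: "(F \<longlongrightarrow> B) at_top"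
  shows "(LBINT t:{0<..}. f t) = B - A"
proof -
  have e: "einterval 0 \<infinity> = {0<..}" by (auto simp: einterval_def)
  have A': "((F \<circ> real_of_ereal) \<longlongrightarrow> A) (at_right 0)"
    using A unfolding zero_ereal_def by (simp add: ereal_tendsto_simps)
  have B': "((F \<circ> real_of_ereal) \<longlongrightarrow> B) (at_left \<infinity>)"
    using B by (simp add: ereal_tendsto_simps)
  have "(LBINT t=0..\<infinity>. f t) = B - A"
    by (rule interval_integral_FTC_integrable[OF _ _ _ _ A' B'])
      (use F f int e in \<open>auto simp: has_real_derivative_iff_has_vector_derivative[symmetric]\<close>)
  then show ?thesis
    by (simp add: interval_lebesgue_integral_0_infty)
qed

lemma set_integral_FTC_Ioo_nonneg:
  fixes f F :: "real \<Rightarrow> real" and a b :: real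
  assumes ab: "a < b"
    and F: "\<And>x. x \<in> {a<..<b} \<Longrightarrow> (F has_real_derivative f x) (at x)"
    and f: "\<And>x. x \<in> {a<..<b} \<Longrightarrow> isCont f x"
    and nonneg: "\<And>x. x \<in> {a<..<b} \<Longrightarrow> 0 \<le> f x"
    and cont: "continuous_on {a..b} F"
  shows "set_integrable lborel {a<..<b} f" "(LBINT x:{a<..<b}. f x) = F b - F a"
proof -
  have A: "((F \<circ> real_of_ereal) \<longlongrightarrow> F a) (at_right (ereal a))"
    using continuous_on_Icc_at_rightD[OF cont ab] by (simp add: ereal_tendsto_simps)
  have B: "((F \<circ> real_of_ereal) \<longlongrightarrow> F b) (at_left (ereal b))"
    using continuous_on_Icc_at_leftD[OF cont ab] by (simp add: ereal_tendsto_simps)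
  note FTC = interval_integral_FTC_nonneg[of "ereal a" "ereal b" F f, OF _ _ _ _ A B]
  show "set_integrable lborel {a<..<b} f"
    unfolding einterval_eq_Icc[symmetric] by (rule FTC(1)) (use ab F f nonneg in auto)
  have "(LBINT x=ereal a..ereal b. f x) = F b - F a"
    by (rule FTC(2)) (use ab F f nonneg in auto)
  then show "(LBINT x:{a<..<b}. f x) = F b - F a"
    using ab by (simp add: interval_integral_eq_integral' interval_lebesgue_integral_def)
qed

lemma nn_integral_eq_set_integral:
  fixes f :: "'a \<Rightarrow> real"
  assumes "set_integrable M A f" "\<And>x. x \<in> A \<Longrightarrow> 0 \<le> f x"
  shows "(\<integral>\<^sup>+x. ennreal (f x) * indicator A x \<partial>M) = ennreal (LINT x:A|M. f x)"
proof -
  have "(\<integral>\<^sup>+x. ennreal (indicator A x *\<^sub>R f x) \<partial>M) = ennreal (\<integral>x. indicator A x *\<^sub>R f x \<partial>M)"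
    using assms by (intro nn_integral_eq_integral) (auto simp: set_integrable_def split: split_indicator)
  also have "(\<integral>\<^sup>+x. ennreal (indicator A x *\<^sub>R f x) \<partial>M) = (\<integral>\<^sup>+x. ennreal (f x) * indicator A x \<partial>M)"
    by (intro nn_integral_cong) (auto split: split_indicator)
  finally show ?thesis by (simp add: set_lebesgue_integral_def)
qed

lemma set_integral_from_nn_integral:
  fixes f :: "'a \<Rightarrow> real"
  assumes m: "set_borel_measurable M A f" and nonneg: "\<And>x. x \<in> A \<Longrightarrow> 0 \<le> f x"
    and nn: "(\<integral>\<^sup>+x. ennreal (f x) * indicator A x \<partial>M) = ennreal r" and r: "0 \<le> r"
  shows "set_integrable M A f" "(LINT x:A|M. f x) = r"
proof -
  have "(\<integral>\<^sup>+x. ennreal (indicator A x *\<^sub>R f x) \<partial>M) = ennreal r"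
    unfolding nn[symmetric] by (intro nn_integral_cong) (auto split: split_indicator)
  then have "has_bochner_integral M (\<lambda>x. indicator A x *\<^sub>R f x) r"
    using m nonneg r
    by (intro has_bochner_integral_nn_integral) (auto simp: set_borel_measurable_def split: split_indicator)
  then show "set_integrable M A f" "(LINT x:A|M. f x) = r"
    by (auto simp: set_integrable_def set_lebesgue_integral_def has_bochner_integral_iff)
qed

text \<open>Nonnegativity lets the order be exchanged in the extended reals; finiteness of the
  result then gives integrability of \<open>g\<close>, which is a conclusion here. Intended use:
  \<open>g\<close> is a parameter integral over \<open>u\<close> whose \<open>t\<close>-integral has
  a closed form for each fixed \<open>u\<close>.\<close>

lemma set_integral_Tonelli:
  fixes f :: "real \<Rightarrow> real \<Rightarrow> real" and A B :: "real set"
  assumes f [measurable]: "(\<lambda>(t, u). f t u) \<in> borel_measurable (borel \<Otimes>\<^sub>M borel)"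
    and sets [measurable]: "A \<in> sets borel" "B \<in> sets borel"
    and nonneg: "\<And>t u. t \<in> A \<Longrightarrow> u \<in> B \<Longrightarrow> 0 \<le> f t u"
    and g: "\<And>t. t \<in> A \<Longrightarrow> set_integrable lborel B (f t)" "\<And>t. t \<in> A \<Longrightarrow> (LBINT u:B. f t u) = g t"
    and gm: "set_borel_measurable lborel A g"
    and k: "\<And>u. u \<in> B \<Longrightarrow> set_integrable lborel A (\<lambda>t. f t u)" "\<And>u. u \<in> B \<Longrightarrow> (LBINT t:A. f t u) = k u"
    and K: "set_integrable lborel B k" "(LBINT u:B. k u) = K"
  shows "set_integrable lborel A g" "(LBINT t:A. g t) = K"
proof -
  have g0: "0 \<le> g t" if "t \<in> A" for t
    unfolding g(2)[OF that, symmetric] set_lebesgue_integral_def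
    by (intro integral_nonneg_AE AE_I2) (use that nonneg in \<open>auto split: split_indicator\<close>)
  have k0: "0 \<le> k u" if "u \<in> B" for u
    unfolding k(2)[OF that, symmetric] set_lebesgue_integral_def
    by (intro integral_nonneg_AE AE_I2) (use that nonneg in \<open>auto split: split_indicator\<close>)
  have K0: "0 \<le> K"
    unfolding K(2)[symmetric] set_lebesgue_integral_def
    by (intro integral_nonneg_AE AE_I2) (use k0 in \<open>auto split: split_indicator\<close>)
  have "(\<integral>\<^sup>+t. ennreal (g t) * indicator A t \<partial>lborel) =
      (\<integral>\<^sup>+t. \<integral>\<^sup>+u. ennreal (f t u) * indicator A t * indicator B u \<partial>lborel \<partial>lborel)"
  proof (intro nn_integral_cong)
    fix t
    show "ennreal (g t) * indicator A t = (\<integral>\<^sup>+u. ennreal (f t u) * indicator A t * indicator B u \<partial>lborel)"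
      using nn_integral_eq_set_integral[OF g(1)[of t] nonneg[of t]] g(2)[of t]
      by (cases "t \<in> A") auto
  qed
  also have "\<dots> = (\<integral>\<^sup>+u. \<integral>\<^sup>+t. ennreal (f t u) * indicator A t * indicator B u \<partial>lborel \<partial>lborel)"
    by (rule lborel_pair.Fubini'[symmetric]) measurable
  also have "\<dots> = (\<integral>\<^sup>+u. ennreal (k u) * indicator B u \<partial>lborel)"
  proof (intro nn_integral_cong)
    fix u
    show "(\<integral>\<^sup>+t. ennreal (f t u) * indicator A t * indicator B u \<partial>lborel) = ennreal (k u) * indicator B u"
      using nn_integral_eq_set_integral[OF k(1)[of u] nonneg[of _ u]] k(2)[of u]
      by (cases "u \<in> B") auto
  qed
  also have "\<dots> = ennreal K"
    using nn_integral_eq_set_integral[OF K(1) k0] K(2) by simp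
  finally have nn: "(\<integral>\<^sup>+t. ennreal (g t) * indicator A t \<partial>lborel) = ennreal K" .
  show "set_integrable lborel A g" "(LBINT t:A. g t) = K"
    using set_integral_from_nn_integral[OF gm g0 nn K0] by auto
qed

lemma set_borel_measurable_continuous_pos:
  fixes f :: "real \<Rightarrow> real"
  assumes "\<And>t. 0 < t \<Longrightarrow> isCont f t"
  shows "set_borel_measurable lborel {0<..} f"
  unfolding set_borel_measurable_def
  using borel_measurable_continuous_on_indicator[of "{0<..}" f]
  by (simp add: assms continuous_at_imp_continuous_on)

lemma set_integrable_bound_pos:
  fixes f g :: "real \<Rightarrow> real"
  assumes g: "set_integrable lborel {0<..} g" and f: "\<And>t. 0 < t \<Longrightarrow> isCont f t"
    and le: "\<And>t. 0 < t \<Longrightarrow> \<bar>f t\<bar> \<le> g t"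
  shows "set_integrable lborel {0<..} f"
proof (rule set_integrable_bound[OF g])
  show "set_borel_measurable lborel {0<..} f"
    by (rule set_borel_measurable_continuous_pos[OF f])
  show "AE t in lborel. t \<in> {0<..} \<longrightarrow> norm (f t) \<le> norm (g t)"
    using le by (intro AE_I2) force
qed

section \<open>Closed forms of the auxiliary hyperbolic integrals\<close>

lemma borel_measurable_sinh_cosh [measurable]:
  "sinh \<in> borel_measurable (borel :: real measure)" "cosh \<in> borel_measurable (borel :: real measure)"
  by (auto intro!: borel_measurable_continuous_onI continuous_intros)

lemma cosh_real_nz: "cosh (t::real) \<noteq> 0"
  using cosh_real_pos[of t] by simp

lemma sinh_sq: "sinh t * sinh t = cosh t * cosh t - (1::real)"
  using cosh_square_eq[of t] by (simp add: power2_eq_square)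

lemma sinh_sq_left: "sinh t * (sinh t * x) = cosh t * (cosh t * x) - (x::real)"
  using cosh_square_eq[of t] by algebra

lemma
  shows set_integrable_tanh_sq_sech: "set_integrable lborel {0<..} (\<lambda>t. (tanh t)\<^sup>2 / cosh t :: real)"
    and integral_tanh_sq_sech: "(LBINT t:{0<..}. (tanh t)\<^sup>2 / cosh t) = pi / 4"
proof -
  \<comment> \<open>Here arctan (sinh t) is the Gudermannian, with derivative sech t, and tanh^2
    sech = sech - sech^3; the second term of the antiderivative accounts for sech^3.\<close>
  have D: "((\<lambda>t. (arctan (sinh t) - sinh t / (cosh t)\<^sup>2) / 2) has_real_derivative (tanh t)\<^sup>2 / cosh t) (at t)" for t :: real
    by (rule derivative_eq_intros refl | simp)+
      (simp add: field_simps power2_eq_square power3_eq_cube power4_eq_xxxx cosh_real_nz sinh_sq tanh_def add_nonneg_eq_0_iff)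
  have A: "((\<lambda>t::real. (arctan (sinh t) - sinh t / (cosh t)\<^sup>2) / 2) \<longlongrightarrow> 0) (at_right 0)" by real_asymp
  have B: "((\<lambda>t::real. (arctan (sinh t) - sinh t / (cosh t)\<^sup>2) / 2) \<longlongrightarrow> pi / 4) at_top" by real_asymp
  note FTC = set_integral_FTC_pos_nonneg[OF D _ _ A B]
  show "set_integrable lborel {0<..} (\<lambda>t. (tanh t)\<^sup>2 / cosh t :: real)"
    by (rule FTC(1)) (auto intro!: continuous_intros simp: cosh_real_nz)
  show "(LBINT t:{0<..}. (tanh t)\<^sup>2 / cosh t) = pi / 4"
    by (rule trans[OF FTC(2)]) (auto intro!: continuous_intros simp: cosh_real_nz)
qed

lemma
  shows set_integrable_t_tanh_sech: "set_integrable lborel {0<..} (\<lambda>t. t * tanh t / cosh t :: real)"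
    and integral_t_tanh_sech: "(LBINT t:{0<..}. t * tanh t / cosh t) = pi / 2"
proof -
  \<comment> \<open>Integration by parts: tanh t sech t is the derivative of - sech t.\<close>
  have D: "((\<lambda>t. arctan (sinh t) - t / cosh t) has_real_derivative t * tanh t / cosh t) (at t)" for t :: real
    by (rule derivative_eq_intros refl | simp)+
      (simp add: field_simps power2_eq_square cosh_real_nz sinh_sq tanh_def add_nonneg_eq_0_iff)
  have A: "((\<lambda>t::real. arctan (sinh t) - t / cosh t) \<longlongrightarrow> 0) (at_right 0)" by real_asymp
  have B: "((\<lambda>t::real. arctan (sinh t) - t / cosh t) \<longlongrightarrow> pi / 2) at_top" by real_asymp
  note FTC = set_integral_FTC_pos_nonneg[OF D _ _ A B]
  show "set_integrable lborel {0<..} (\<lambda>t. t * tanh t / cosh t :: real)"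
    by (rule FTC(1)) (auto intro!: continuous_intros simp: cosh_real_nz)
  show "(LBINT t:{0<..}. t * tanh t / cosh t) = pi / 2"
    by (rule trans[OF FTC(2)]) (auto intro!: continuous_intros simp: cosh_real_nz)
qed

lemma
  shows set_integrable_t_tanh_sech_cube: "set_integrable lborel {0<..} (\<lambda>t. t * tanh t / cosh t ^ 3 :: real)"
    and integral_t_tanh_sech_cube: "(LBINT t:{0<..}. t * tanh t / cosh t ^ 3) = pi / 12"
proof -
  \<comment> \<open>By parts, since tanh t sech^3 t is the derivative of - sech^3 t / 3; the
    remaining integral of sech^3 is half of arctan (sinh t) + sinh t / cosh^2 t.\<close>
  define F where "F t = (arctan (sinh t) + sinh t / (cosh t)\<^sup>2) / 6 - t / (3 * cosh t ^ 3)" for t :: real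
  have D: "(F has_real_derivative t * tanh t / cosh t ^ 3) (at t)" for t :: real
    unfolding F_def
    by (rule derivative_eq_intros refl | simp)+
      (simp add: field_simps power2_eq_square power3_eq_cube power4_eq_xxxx cosh_real_nz sinh_sq tanh_def add_nonneg_eq_0_iff,
       simp add: eval_nat_numeral)
  have A: "(F \<longlongrightarrow> 0) (at_right 0)" unfolding F_def by real_asymp
  have B: "(F \<longlongrightarrow> pi / 12) at_top" unfolding F_def by real_asymp
  note FTC = set_integral_FTC_pos_nonneg[OF D _ _ A B]
  show "set_integrable lborel {0<..} (\<lambda>t. t * tanh t / cosh t ^ 3 :: real)"
    by (rule FTC(1)) (auto intro!: continuous_intros simp: cosh_real_nz)
  show "(LBINT t:{0<..}. t * tanh t / cosh t ^ 3) = pi / 12"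
    by (rule trans[OF FTC(2)]) (auto intro!: continuous_intros simp: cosh_real_nz)
qed

text \<open>Tonelli for \<open>ln (cosh t) = \<integral>\<^sub>0\<^sup>1 u sinh\<^sup>2 t / (1 + u\<^sup>2 sinh\<^sup>2 t) du\<close>.\<close>

lemma
  shows set_integrable_ln_cosh_sech: "set_integrable lborel {0<..} (\<lambda>t. ln (cosh t) / cosh t :: real)"
    and integral_ln_cosh_sech: "(LBINT t:{0<..}. ln (cosh t) / cosh t) = pi / 2 * ln 2"
proof -
  define f where "f t u = u * (sinh t)\<^sup>2 / ((1 + u\<^sup>2 * (sinh t)\<^sup>2) * cosh t)" for t u :: real
  have pos: "0 < 1 + u\<^sup>2 * (sinh t)\<^sup>2" for t u :: real
    by (intro add_pos_nonneg) auto
  have c2: "(cosh t)\<^sup>2 = 1 + (sinh t)\<^sup>2" for t :: real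
    by (simp add: cosh_square_eq)
  have m: "(\<lambda>(t, u). f t u) \<in> borel_measurable (borel \<Otimes>\<^sub>M borel)"
    unfolding f_def by measurable
  have nonneg: "0 \<le> f t u" if "u \<in> {0<..<1}" for t u
    unfolding f_def using that pos[of u t] by simp
  have g: "set_integrable lborel {0<..<1} (f t)" "(LBINT u:{0<..<1}. f t u) = ln (cosh t) / cosh t" for t
  proof -
    have D: "((\<lambda>u. ln (1 + u\<^sup>2 * (sinh t)\<^sup>2) / (2 * cosh t)) has_real_derivative f t u) (at u)" for u
    proof -
      have "((\<lambda>u. ln (1 + u\<^sup>2 * (sinh t)\<^sup>2)) has_real_derivative 2 * u * (sinh t)\<^sup>2 / (1 + u\<^sup>2 * (sinh t)\<^sup>2)) (at u)"
        using pos[of u t] by (auto intro!: derivative_eq_intros)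
      from DERIV_cdivide[OF this, of "2 * cosh t"] show ?thesis
        by (simp add: f_def)
    qed
    have c: "isCont (f t) u" for u
      unfolding f_def using pos[of u t] by (auto intro!: continuous_intros simp: cosh_real_nz)
    have C: "continuous_on {0..1} (\<lambda>u. ln (1 + u\<^sup>2 * (sinh t)\<^sup>2) / (2 * cosh t))"
      by (rule DERIV_continuous_on) (rule DERIV_subset[OF D], simp)
    note FTC = set_integral_FTC_Ioo_nonneg[OF zero_less_one D c nonneg C]
    show "set_integrable lborel {0<..<1} (f t)" by (rule FTC(1)) auto
    have "(LBINT u:{0<..<1}. f t u) = ln ((cosh t)\<^sup>2) / (2 * cosh t)"
      by (rule trans[OF FTC(2)]) (simp_all add: c2)
    then show "(LBINT u:{0<..<1}. f t u) = ln (cosh t) / cosh t"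
      by (simp add: ln_realpow)
  qed
  have k: "set_integrable lborel {0<..} (\<lambda>t. f t u)" "(LBINT t:{0<..}. f t u) = pi / 2 / (1 + u)"
    if u: "u \<in> {0<..<1}" for u
  proof -
    \<comment> \<open>In the variable v = sinh t the integrand is u v^2 / ((1 + u^2 v^2)(1 + v^2)),
      and \<open>F\<close> integrates its partial fractions. The open range of \<open>u\<close>
      keeps both \<open>u\<close> and 1 - u^2 away from 0.\<close>
    define F where "F t = u / (1 - u\<^sup>2) * (arctan (u * sinh t) / u - arctan (sinh t))" for t
    have u2: "0 < 1 - u\<^sup>2" using u by (simp add: power_less_one_iff abs_square_less_1)
    have D: "(F has_real_derivative f t u) (at t)" for t
    proof -
      have "(F has_real_derivative u / (1 - u\<^sup>2) *
          (u * cosh t / (1 + u\<^sup>2 * (sinh t)\<^sup>2) / u - cosh t / (1 + (sinh t)\<^sup>2))) (at t)"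
        unfolding F_def
      proof (intro DERIV_cmult DERIV_diff DERIV_cdivide)
        show "((\<lambda>t. arctan (u * sinh t)) has_real_derivative u * cosh t / (1 + u\<^sup>2 * (sinh t)\<^sup>2)) (at t)"
          by (auto intro!: derivative_eq_intros simp: power_mult_distrib divide_inverse)
        show "((\<lambda>t. arctan (sinh t)) has_real_derivative cosh t / (1 + (sinh t)\<^sup>2)) (at t)"
          by (auto intro!: derivative_eq_intros simp: divide_inverse)
      qed
      moreover have "u / (1 - u\<^sup>2) * (u * cosh t / (1 + u\<^sup>2 * (sinh t)\<^sup>2) / u - cosh t / (1 + (sinh t)\<^sup>2)) = f t u"
      proof -
        have "u * cosh t / (1 + u\<^sup>2 * (sinh t)\<^sup>2) / u - cosh t / (1 + (sinh t)\<^sup>2) =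
            cosh t * ((1 + (sinh t)\<^sup>2) - (1 + u\<^sup>2 * (sinh t)\<^sup>2)) / ((1 + u\<^sup>2 * (sinh t)\<^sup>2) * (1 + (sinh t)\<^sup>2))"
        proof -
          have "u * c / P / u - c / Q = c * (Q - P) / (P * Q)" if "0 < P" "0 < Q" for c P Q :: real
            using that u by (simp add: diff_frac_eq right_diff_distrib)
          from this[OF pos[of u t], of "1 + (sinh t)\<^sup>2" "cosh t"] pos[of 1 t] show ?thesis by simp
        qed
        also have "\<dots> = cosh t * ((1 - u\<^sup>2) * (sinh t)\<^sup>2) / ((1 + u\<^sup>2 * (sinh t)\<^sup>2) * (cosh t * cosh t))"
          using c2[of t] by (simp add: power2_eq_square algebra_simps)
        finally have E: "u * cosh t / (1 + u\<^sup>2 * (sinh t)\<^sup>2) / u - cosh t / (1 + (sinh t)\<^sup>2) = \<dots>" .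
        show ?thesis
          unfolding E using u2 by (simp add: f_def cosh_real_nz)
      qed
      ultimately show ?thesis by simp
    qed
    have c: "isCont (\<lambda>t. f t u) t" for t
      unfolding f_def using pos[of u t] by (auto intro!: continuous_intros simp: cosh_real_nz)
    have A: "(F \<longlongrightarrow> 0) (at_right 0)"
      using DERIV_isCont[OF D[of 0]] by (simp add: isCont_def filterlim_at_split F_def)
    have "(F \<longlongrightarrow> u / (1 - u\<^sup>2) * (pi / 2 / u - pi / 2)) at_top"
      unfolding F_def
      by (intro tendsto_intros filterlim_compose[OF tendsto_arctan_at_top]
          filterlim_tendsto_pos_mult_at_top[OF tendsto_const]) (use u in \<open>auto, real_asymp+\<close>)
    also have "u / (1 - u\<^sup>2) * (pi / 2 / u - pi / 2) = pi / 2 / (1 + u)"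
      using u u2 by (simp add: divide_simps) (simp add: algebra_simps power2_eq_square)
    finally have B: "(F \<longlongrightarrow> pi / 2 / (1 + u)) at_top" .
    note FTC = set_integral_FTC_pos_nonneg[OF D c nonneg[OF u] A B]
    show "set_integrable lborel {0<..} (\<lambda>t. f t u)" "(LBINT t:{0<..}. f t u) = pi / 2 / (1 + u)"
      using FTC by simp_all
  qed
  have K: "set_integrable lborel {0<..<1} (\<lambda>u::real. pi / 2 / (1 + u))"
    "(LBINT u:{0<..<1}. pi / 2 / (1 + u)) = pi / 2 * ln 2"
  proof -
    have D: "((\<lambda>u. pi / 2 * ln (1 + u)) has_real_derivative pi / 2 / (1 + u)) (at u)" if "0 \<le> u" for u :: real
      using that by (auto intro!: derivative_eq_intros simp: field_simps)
    have C: "continuous_on {0..1} (\<lambda>u::real. pi / 2 * ln (1 + u))"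
      by (auto intro!: continuous_intros)
    note FTC = set_integral_FTC_Ioo_nonneg[OF zero_less_one D _ _ C]
    show "set_integrable lborel {0<..<1} (\<lambda>u::real. pi / 2 / (1 + u))"
      by (rule FTC(1)) (auto intro!: continuous_intros)
    show "(LBINT u:{0<..<1}. pi / 2 / (1 + u)) = pi / 2 * ln 2"
      by (rule trans[OF FTC(2)]) (auto intro!: continuous_intros)
  qed
  have gm: "set_borel_measurable lborel {0<..} (\<lambda>t. ln (cosh t) / cosh t :: real)"
    by (rule set_borel_measurable_continuous_pos) (auto intro!: continuous_intros simp: cosh_real_nz)
  note T = set_integral_Tonelli[OF m _ _ nonneg g gm k K]
  show "set_integrable lborel {0<..} (\<lambda>t. ln (cosh t) / cosh t :: real)"
    by (rule T(1)) auto
  show "(LBINT t:{0<..}. ln (cosh t) / cosh t) = pi / 2 * ln 2"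
    by (rule T(2)) auto
qed


text \<open>Integration by parts: \<open>?F\<close> vanishes at both ends, and since (sinh /
  cosh^2)' = sech - 2 tanh^2 sech, its derivative is the integrand minus half of ln cosh sech and
  half of tanh^2 sech. Both remaining integrals are known.\<close>

lemma
  shows set_integrable_tanh_sq_sech_ln_cosh: "set_integrable lborel {0<..} (\<lambda>t. (tanh t)\<^sup>2 / cosh t * ln (cosh t) :: real)"
    and integral_tanh_sq_sech_ln_cosh: "(LBINT t:{0<..}. (tanh t)\<^sup>2 / cosh t * ln (cosh t)) = pi / 4 * ln 2 + pi / 8"
proof -
  let ?f = "\<lambda>t. (tanh t)\<^sup>2 / cosh t * ln (cosh t) :: real"
  let ?g = "\<lambda>t. ln (cosh t) / cosh t :: real"
  let ?h = "\<lambda>t. (tanh t)\<^sup>2 / cosh t :: real"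
  let ?F = "\<lambda>t. - (sinh t / (2 * (cosh t)\<^sup>2) * ln (cosh t)) :: real"
  have c: "isCont ?f t" "isCont ?g t" "isCont ?h t" for t
    by (auto intro!: continuous_intros simp: cosh_real_nz)
  show f: "set_integrable lborel {0<..} ?f"
  proof (rule set_integrable_bound_pos[OF set_integrable_ln_cosh_sech c(1)])
    fix t :: real
    have "(tanh t)\<^sup>2 \<le> 1"
      using tanh_real_bounds[of t] by (auto simp: abs_square_le_1 abs_le_iff)
    moreover have "0 \<le> ln (cosh t) / cosh t"
      using cosh_real_ge_1[of t] by simp
    ultimately have "(tanh t)\<^sup>2 * (ln (cosh t) / cosh t) \<le> 1 * (ln (cosh t) / cosh t)"
      by (intro mult_right_mono)
    then show "\<bar>?f t\<bar> \<le> ?g t"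
      using cosh_real_ge_1[of t] by (simp add: abs_mult)
  qed
  have g: "set_integrable lborel {0<..} (\<lambda>t. ?g t / 2)" and h: "set_integrable lborel {0<..} (\<lambda>t. ?h t / 2)"
    by (intro set_integrable_divide set_integrable_ln_cosh_sech set_integrable_tanh_sq_sech)+
  have D: "(?F has_real_derivative ?f t - ?g t / 2 - ?h t / 2) (at t)" for t
    by (rule derivative_eq_intros refl | simp add: cosh_real_nz)+
      (simp add: field_simps power2_eq_square power3_eq_cube power4_eq_xxxx cosh_real_nz sinh_sq sinh_sq_left tanh_def add_nonneg_eq_0_iff)
  have A: "(?F \<longlongrightarrow> 0) (at_right 0)" by real_asymp
  have B: "(?F \<longlongrightarrow> 0) at_top" by real_asymp
  have "(LBINT t:{0<..}. ?f t - ?g t / 2 - ?h t / 2) = 0 - 0"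
  proof (rule set_integral_FTC_pos[OF D _ _ A B])
    show "isCont (\<lambda>t. ?f t - ?g t / 2 - ?h t / 2) t" for t
      by (intro continuous_diff continuous_divide c) auto
    show "set_integrable lborel {0<..} (\<lambda>t. ?f t - ?g t / 2 - ?h t / 2)"
      by (intro set_integral_diff f g h)
  qed
  also have "(LBINT t:{0<..}. ?f t - ?g t / 2 - ?h t / 2) = (LBINT t:{0<..}. ?f t) - (pi / 2 * ln 2) / 2 - (pi / 4) / 2"
    by (simp only: set_integral_diff f g h set_integral_divide_zero integral_ln_cosh_sech integral_tanh_sq_sech)
  finally show "(LBINT t:{0<..}. ?f t) = pi / 4 * ln 2 + pi / 8"
    by simp
qed

text \<open>Tonelli for the integral of \<open>2 cos a cosh t / (cosh\<^sup>2 t - sin\<^sup>2 a)\<close> over \<open>0 < a < \<pi>/6\<close>.\<close>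

lemma
  fixes g :: "real \<Rightarrow> real"
  defines "g \<equiv> \<lambda>t. ln (cosh t + 1 / 2) - ln (cosh t - 1 / 2)"
  shows set_integrable_ln_cosh_quotient: "set_integrable lborel {0<..} g"
    and integral_ln_cosh_quotient: "(LBINT t:{0<..}. g t) = pi\<^sup>2 / 6"
proof -
  \<comment> \<open>In \<open>a\<close> this is the derivative of ln (cosh t + sin a) - ln (cosh t -
    sin a), which is 0 at a = 0 and \<open>g t\<close> at a = \<pi>/6, where sin a = 1/2. In
    \<open>t\<close> it is the derivative of 2 arctan (sinh t / cos a), whose total increase \<pi>
    does not depend on \<open>a\<close>; hence \<pi> times \<pi>/6.\<close>
  define f where "f t a = 2 * cos a * cosh t / ((cosh t)\<^sup>2 - (sin a)\<^sup>2)" for t a :: real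
  have dn: "(cosh t)\<^sup>2 - (sin a)\<^sup>2 = (sinh t)\<^sup>2 + (cos a)\<^sup>2" for t a :: real
    by (simp add: cosh_square_eq sin_squared_eq)
  have cp: "0 < cos a" if "a \<in> {0<..<pi / 6}" for a :: real
    using that by (intro cos_gt_zero) auto
  have pos: "0 < (cosh t)\<^sup>2 - (sin a)\<^sup>2" if "a \<in> {0<..<pi / 6}" for t a :: real
    unfolding dn using cp[OF that] by (intro add_nonneg_pos) auto
  have m: "(\<lambda>(t, a). f t a) \<in> borel_measurable (borel \<Otimes>\<^sub>M borel)"
    unfolding f_def by measurable
  have nonneg: "0 \<le> f t a" if "a \<in> {0<..<pi / 6}" for t a
    unfolding f_def using cp[OF that] pos[OF that, of t] by simp
  have s: "\<bar>sin a\<bar> < cosh t" if "0 < t" for a t :: real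
  proof -
    have "1 < cosh t" using cosh_real_strict_mono[of 0 t] that by simp
    then show ?thesis using abs_sin_le_one[of a] by linarith
  qed
  have g: "set_integrable lborel {0<..<pi / 6} (f t)" "(LBINT a:{0<..<pi / 6}. f t a) = g t"
    if t: "t \<in> {0<..}" for t
  proof -
    have s': "sin a < cosh t" "0 < cosh t + sin a" for a
      using s[of t a] t by auto
    have D: "((\<lambda>a. ln (cosh t + sin a) - ln (cosh t - sin a)) has_real_derivative f t a) (at a)" for a
    proof -
      have "((\<lambda>a. ln (cosh t + sin a) - ln (cosh t - sin a)) has_real_derivative
          cos a / (cosh t + sin a) - - cos a / (cosh t - sin a)) (at a)"
        using s'[of a] by (auto intro!: derivative_eq_intros)
      also have "cos a / (cosh t + sin a) - - cos a / (cosh t - sin a) = f t a"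
      proof -
        have "(cosh t)\<^sup>2 - (sin a)\<^sup>2 = (cosh t + sin a) * (cosh t - sin a)"
          by (simp add: power2_eq_square algebra_simps)
        moreover have "cosh t + sin a \<noteq> 0" "cosh t - sin a \<noteq> 0" using s'[of a] by auto
        ultimately show ?thesis
          by (simp add: f_def divide_simps) (simp add: algebra_simps)
      qed
      finally show ?thesis .
    qed
    have c: "isCont (f t) a" if "a \<in> {0<..<pi / 6}" for a
      unfolding f_def using pos[OF that, of t] by (auto intro!: continuous_intros)
    have C: "continuous_on {0..pi / 6} (\<lambda>a. ln (cosh t + sin a) - ln (cosh t - sin a))"
      by (rule DERIV_continuous_on) (rule DERIV_subset[OF D], simp)
    have p: "0 < pi / 6" by simp
    note FTC = set_integral_FTC_Ioo_nonneg[OF p D c nonneg C]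
    show "set_integrable lborel {0<..<pi / 6} (f t)" by (rule FTC(1)) auto
    show "(LBINT a:{0<..<pi / 6}. f t a) = g t"
      by (rule trans[OF FTC(2)]) (simp_all add: g_def sin_30)
  qed
  have k: "set_integrable lborel {0<..} (\<lambda>t. f t a)" "(LBINT t:{0<..}. f t a) = pi"
    if a: "a \<in> {0<..<pi / 6}" for a
  proof -
    define F where "F t = 2 * arctan (sinh t / cos a)" for t
    note ca = cp[OF a]
    have D: "(F has_real_derivative f t a) (at t)" for t
    proof -
      have "(F has_real_derivative 2 * (cosh t / cos a / (1 + (sinh t / cos a)\<^sup>2))) (at t)"
        unfolding F_def using ca by (auto intro!: derivative_eq_intros simp: divide_inverse)
      also have "2 * (cosh t / cos a / (1 + (sinh t / cos a)\<^sup>2)) = f t a"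
        unfolding f_def dn using ca by (simp add: divide_simps power2_eq_square add_nonneg_eq_0_iff)
      finally show ?thesis .
    qed
    have c: "isCont (\<lambda>t. f t a) t" for t
      unfolding f_def using pos[OF a, of t] by (auto intro!: continuous_intros)
    have A: "(F \<longlongrightarrow> 0) (at_right 0)"
      unfolding F_def using ca by real_asymp
    have B: "(F \<longlongrightarrow> pi) at_top"
      unfolding F_def using ca by real_asymp
    note FTC = set_integral_FTC_pos_nonneg[OF D c nonneg[OF a] A B]
    show "set_integrable lborel {0<..} (\<lambda>t. f t a)" "(LBINT t:{0<..}. f t a) = pi"
      using FTC by simp_all
  qed
  have K: "set_integrable lborel {0<..<pi / 6} (\<lambda>a::real. pi)" "(LBINT a:{0<..<pi / 6}. pi) = pi\<^sup>2 / 6"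
    by (simp_all add: set_integrable_def set_lebesgue_integral_def power2_eq_square)
  have gm: "set_borel_measurable lborel {0<..} g"
  proof (rule set_borel_measurable_continuous_pos)
    fix t :: real
    have "1 / 2 < cosh t" using cosh_real_ge_1[of t] by linarith
    then show "isCont g t" unfolding g_def by (auto intro!: continuous_intros)
  qed
  note T = set_integral_Tonelli[OF m _ _ nonneg g gm k K]
  show "set_integrable lborel {0<..} g"
    by (rule T(1)) auto
  show "(LBINT t:{0<..}. g t) = pi\<^sup>2 / 6"
    by (rule T(2)) auto
qed

text \<open>Integration by parts: the derivative of \<open>?g\<close> is - 4 sinh t / (4 cosh^2 t -
  1), so a quarter of the integral of \<open>?g\<close> remains. Integrability follows from 4 cosh^2
  - 1 \<ge> cosh^2 by comparison with t tanh t sech t.\<close>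

lemma
  shows set_integrable_t_sinh_cosh: "set_integrable lborel {0<..} (\<lambda>t. t * sinh t / (4 * (cosh t)\<^sup>2 - 1) :: real)"
    and integral_t_sinh_cosh: "(LBINT t:{0<..}. t * sinh t / (4 * (cosh t)\<^sup>2 - 1)) = pi\<^sup>2 / 24"
proof -
  let ?f = "\<lambda>t. t * sinh t / (4 * (cosh t)\<^sup>2 - 1) :: real"
  let ?g = "\<lambda>t. ln (cosh t + 1 / 2) - ln (cosh t - 1 / 2) :: real"
  let ?F = "\<lambda>t. - (t * ?g t) / 4"
  have c1: "1 \<le> (cosh t)\<^sup>2" for t :: real
    using cosh_real_ge_1[of t] by (simp add: one_le_power)
  have ch: "1 / 2 < cosh t" for t :: real
    using cosh_real_ge_1[of t] by linarith
  have d: "4 * (cosh t)\<^sup>2 - 1 \<noteq> 0" for t :: real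
    using c1[of t] by simp
  have cf: "isCont ?f t" for t
    using d by (auto intro!: continuous_intros)
  have cg: "isCont ?g t" for t
    using ch[of t] by (auto intro!: continuous_intros)
  show f: "set_integrable lborel {0<..} ?f"
  proof (rule set_integrable_bound_pos[OF set_integrable_t_tanh_sech cf])
    fix t :: real assume t: "0 < t"
    have "\<bar>?f t\<bar> = t * sinh t / (4 * (cosh t)\<^sup>2 - 1)"
      using t c1[of t] by (simp add: abs_mult)
    also have "\<dots> \<le> t * sinh t / (cosh t)\<^sup>2"
      using t c1[of t] by (intro divide_left_mono) auto
    also have "\<dots> = t * tanh t / cosh t"
      by (simp add: tanh_def power2_eq_square)
    finally show "\<bar>?f t\<bar> \<le> t * tanh t / cosh t" .
  qed
  have g: "set_integrable lborel {0<..} (\<lambda>t. ?g t / 4)"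
    using set_integrable_ln_cosh_quotient by (simp add: set_integrable_divide)
  have D: "(?F has_real_derivative ?f t - ?g t / 4) (at t)" for t
  proof -
    have "(?F has_real_derivative - (1 * ?g t + (sinh t / (cosh t + 1 / 2) - sinh t / (cosh t - 1 / 2)) * t) / 4) (at t)"
      using ch[of t]
      by (intro DERIV_cdivide DERIV_minus DERIV_mult DERIV_ident DERIV_diff) (auto intro!: derivative_eq_intros)
    also have "sinh t / (cosh t + 1 / 2) - sinh t / (cosh t - 1 / 2) = - 4 * sinh t / (4 * (cosh t)\<^sup>2 - 1)"
      using ch[of t] d[of t] by (simp add: divide_simps power2_eq_square) (simp add: algebra_simps)
    finally show ?thesis by (simp add: field_simps)
  qed
  have A: "(?F \<longlongrightarrow> 0) (at_right 0)" by real_asymp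
  have B: "(?F \<longlongrightarrow> 0) at_top" by real_asymp
  have "(LBINT t:{0<..}. ?f t - ?g t / 4) = 0 - 0"
  proof (rule set_integral_FTC_pos[OF D _ _ A B])
    show "isCont (\<lambda>t. ?f t - ?g t / 4) t" for t
      by (intro continuous_diff continuous_divide cf cg) auto
    show "set_integrable lborel {0<..} (\<lambda>t. ?f t - ?g t / 4)"
      by (intro set_integral_diff f g)
  qed
  also have "(LBINT t:{0<..}. ?f t - ?g t / 4) = (LBINT t:{0<..}. ?f t) - (pi\<^sup>2 / 6) / 4"
    by (simp only: set_integral_diff f g set_integral_divide_zero integral_ln_cosh_quotient)
  finally show "(LBINT t:{0<..}. ?f t) = pi\<^sup>2 / 24"
    by simp
qed

section \<open>The coth integral: integrability and the cases n = 2 and n = 3\<close>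

lemma coth_antimono_scaled:
  fixes t :: real
  assumes "n \<ge> 1" "0 < t"
  shows "cosh (real n * t) / sinh (real n * t) \<le> cosh t / sinh t"
proof -
  have "t \<le> real n * t" using assms by simp
  then have "tanh t \<le> tanh (real n * t)" by simp
  moreover have "0 < tanh t" using assms by simp
  ultimately have "inverse (tanh (real n * t)) \<le> inverse (tanh t)"
    by (intro le_imp_inverse_le)
  then show ?thesis by (simp add: tanh_def)
qed

text \<open>Because coth (n t) \<le> coth t, the case n = 1, where the integrand is just t tanh t
  sech t, dominates all others.\<close>

lemma set_integrable_coth:
  fixes n :: nat
  assumes n: "n \<ge> 1"
  shows "set_integrable lborel {0<..} (\<lambda>t. t * (cosh (real n * t) / sinh (real n * t)) * (tanh t)\<^sup>2 * (1 / cosh t))"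
proof (rule set_integrable_bound_pos[OF set_integrable_t_tanh_sech])
  fix t :: real assume t: "0 < t"
  show "isCont (\<lambda>t. t * (cosh (real n * t) / sinh (real n * t)) * (tanh t)\<^sup>2 * (1 / cosh t)) t"
    using t n by (auto intro!: continuous_intros simp: cosh_real_nz)
  have "\<bar>t * (cosh (real n * t) / sinh (real n * t)) * (tanh t)\<^sup>2 * (1 / cosh t)\<bar> =
      (cosh (real n * t) / sinh (real n * t)) * (t * (tanh t)\<^sup>2 * (1 / cosh t))"
    using t n by (simp add: abs_mult)
  also have "\<dots> \<le> (cosh t / sinh t) * (t * (tanh t)\<^sup>2 * (1 / cosh t))"
    using t coth_antimono_scaled[OF n t] by (intro mult_right_mono) auto
  also have "\<dots> = t * tanh t / cosh t"
    using t by (simp add: tanh_def power2_eq_square)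
  finally show "\<bar>t * (cosh (real n * t) / sinh (real n * t)) * (tanh t)\<^sup>2 * (1 / cosh t)\<bar> \<le> t * tanh t / cosh t" .
qed

text \<open>The identity coth (2t) = (2 cosh^2 t - 1) / (2 sinh t cosh t) splits the integrand into
  t tanh t sech t and half of t tanh t sech^3 t.\<close>

lemma integral_coth_2:
  "(LBINT t:{0<..}. t * (cosh (real 2 * t) / sinh (real 2 * t)) * (tanh t)\<^sup>2 * (1 / cosh t)) = 11 * pi / 24"
proof -
  have "(LBINT t:{0<..}. t * (cosh (real 2 * t) / sinh (real 2 * t)) * (tanh t)\<^sup>2 * (1 / cosh t)) =
      (LBINT t:{0<..}. t * tanh t / cosh t - (t * tanh t / cosh t ^ 3) / 2)"
  proof (intro set_lebesgue_integral_cong allI impI)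
    fix t :: real assume "t \<in> {0<..}"
    then have s: "0 < sinh t" by simp
    then show "t * (cosh (real 2 * t) / sinh (real 2 * t)) * (tanh t)\<^sup>2 * (1 / cosh t) =
        t * tanh t / cosh t - (t * tanh t / cosh t ^ 3) / 2"
      by (simp add: cosh_double sinh_double tanh_def divide_simps cosh_real_nz)
        (simp add: power2_eq_square power3_eq_cube sinh_sq sinh_sq_left algebra_simps)
  qed simp
  also have "\<dots> = (LBINT t:{0<..}. t * tanh t / cosh t) - (LBINT t:{0<..}. (t * tanh t / cosh t ^ 3) / 2)"
    by (intro set_integral_diff set_integrable_divide set_integrable_t_tanh_sech set_integrable_t_tanh_sech_cube)
  also have "\<dots> = pi / 2 - (pi / 12) / 2"
    by (simp only: set_integral_divide_zero integral_t_tanh_sech integral_t_tanh_sech_cube)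
  finally show ?thesis by simp
qed

text \<open>The triple-argument formulas give coth (3t) = coth t (4c - 3)/(4c - 1) with c = cosh^2
  t, and partial fractions in c, (4c - 3)/(c(4c - 1)) = 3/c - 8/(4c - 1), produce the coefficients 3
  and 8.\<close>

lemma integral_coth_3:
  "(LBINT t:{0<..}. t * (cosh (real 3 * t) / sinh (real 3 * t)) * (tanh t)\<^sup>2 * (1 / cosh t)) = 3 * pi / 2 - pi\<^sup>2 / 3"
proof -
  have "(LBINT t:{0<..}. t * (cosh (real 3 * t) / sinh (real 3 * t)) * (tanh t)\<^sup>2 * (1 / cosh t)) =
      (LBINT t:{0<..}. 3 * (t * tanh t / cosh t) - 8 * (t * sinh t / (4 * (cosh t)\<^sup>2 - 1)))"
  proof (intro set_lebesgue_integral_cong allI impI)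
    fix t :: real assume "t \<in> {0<..}"
    then have s: "0 < sinh t" by simp
    have c1: "1 \<le> (cosh t)\<^sup>2"
      using cosh_real_ge_1[of t] by (simp add: one_le_power)
    have e: "real 3 * t = 2 * t + t" by simp
    have "cosh (real 3 * t) = cosh t * (4 * (cosh t)\<^sup>2 - 3)"
      unfolding e cosh_add cosh_double sinh_double
      by (simp add: sinh_square_eq) (simp add: algebra_simps power2_eq_square sinh_sq sinh_sq_left)
    moreover have "sinh (real 3 * t) = sinh t * (4 * (cosh t)\<^sup>2 - 1)"
      unfolding e sinh_add cosh_double sinh_double
      by (simp add: sinh_square_eq) (simp add: algebra_simps power2_eq_square)
    ultimately show "t * (cosh (real 3 * t) / sinh (real 3 * t)) * (tanh t)\<^sup>2 * (1 / cosh t) =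
        3 * (t * tanh t / cosh t) - 8 * (t * sinh t / (4 * (cosh t)\<^sup>2 - 1))"
      using s c1
      by (simp add: tanh_def divide_simps cosh_real_nz) (simp add: power2_eq_square sinh_sq sinh_sq_left algebra_simps)
  qed simp
  also have "\<dots> = (LBINT t:{0<..}. 3 * (t * tanh t / cosh t)) - (LBINT t:{0<..}. 8 * (t * sinh t / (4 * (cosh t)\<^sup>2 - 1)))"
    by (intro set_integral_diff set_integrable_mult_right set_integrable_t_tanh_sech set_integrable_t_sinh_cosh)
  also have "\<dots> = 3 * (pi / 2) - 8 * (pi\<^sup>2 / 24)"
    by (simp only: set_integral_mult_right integral_t_tanh_sech integral_t_sinh_cosh)
  finally show ?thesis by simp
qed

section \<open>The logarithmic integral over the disc\<close>

text \<open>The argument of the second logarithm is affine in \<open>y\<close>, equal to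
  \<open>b\<close> at -\<beta> and \<open>a\<close> at \<beta>. An antiderivative of ln L is (L ln L
  - L) divided by the slope (a - b)/(2 \<beta>). Subtracting from \<open>ln c\<close> with
  \<open>b \<le> c\<close> makes the integrand nonnegative, so integrability comes with the
  value.\<close>

lemma
  fixes a b c \<beta> :: real
  assumes \<beta>: "0 < \<beta>" and a: "0 < a" and ab: "a < b" and bc: "b \<le> c"
  defines "f \<equiv> \<lambda>y. ln c - ln ((1 + y / \<beta>) / 2 * a + (1 - y / \<beta>) / 2 * b)"
  shows ln_linear_nonneg: "\<And>y. y \<in> {-\<beta><..<\<beta>} \<Longrightarrow> 0 \<le> f y"
    and set_integrable_ln_linear: "set_integrable lborel {-\<beta><..<\<beta>} f"
    and integral_ln_linear: "(LBINT y:{-\<beta><..<\<beta>}. f y) = 2 * \<beta> * (ln c + 1 - (a * ln a - b * ln b) / (a - b))"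
proof -
  define L where "L y = (1 + y / \<beta>) / 2 * a + (1 - y / \<beta>) / 2 * b" for y
  define F where "F y = ln c * y - 2 * \<beta> / (a - b) * (L y * ln (L y) - L y)" for y
  have L: "a \<le> L y" "L y \<le> b" if "y \<in> {-\<beta>..\<beta>}" for y
  proof -
    have s: "0 \<le> (1 + y / \<beta>) / 2" "0 \<le> (1 - y / \<beta>) / 2" using that \<beta> by (auto simp: field_simps)
    have "a = (1 + y / \<beta>) / 2 * a + (1 - y / \<beta>) / 2 * a" by (simp add: field_simps)
    also have "\<dots> \<le> L y" unfolding L_def using ab s by (intro add_mono mult_left_mono) auto
    finally show "a \<le> L y" .
    have "L y \<le> (1 + y / \<beta>) / 2 * b + (1 - y / \<beta>) / 2 * b"
      unfolding L_def using ab s by (intro add_mono mult_left_mono) auto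
    also have "\<dots> = b" by (simp add: field_simps)
    finally show "L y \<le> b" .
  qed
  have L0: "0 < L y" if "y \<in> {-\<beta>..\<beta>}" for y
    using L(1)[OF that] a by linarith
  show nonneg: "0 \<le> f y" if "y \<in> {-\<beta><..<\<beta>}" for y
  proof -
    have "ln (L y) \<le> ln c" using L[of y] L0[of y] that bc by auto
    then show ?thesis by (simp add: f_def L_def)
  qed
  have D: "(F has_real_derivative f y) (at y)" if "y \<in> {-\<beta>..\<beta>}" for y
  proof -
    have DL: "(L has_real_derivative (a - b) / (2 * \<beta>)) (at y)"
      unfolding L_def using \<beta> by (auto intro!: derivative_eq_intros simp: field_simps)
    have "(F has_real_derivative ln c - 2 * \<beta> / (a - b) * ((a - b) / (2 * \<beta>) * ln (L y))) (at y)"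
      unfolding F_def using L0[OF that]
      by (auto intro!: derivative_eq_intros DL)
    also have "ln c - 2 * \<beta> / (a - b) * ((a - b) / (2 * \<beta>) * ln (L y)) = f y"
      using ab \<beta> by (simp add: f_def L_def)
    finally show ?thesis .
  qed
  have c: "isCont f y" if "y \<in> {-\<beta><..<\<beta>}" for y
    unfolding f_def using L0[of y] that \<beta> by (auto intro!: continuous_intros simp: L_def)
  have C: "continuous_on {-\<beta>..\<beta>} F"
    by (rule DERIV_continuous_on) (rule DERIV_subset[OF D], auto)
  have D': "(F has_real_derivative f y) (at y)" if "y \<in> {-\<beta><..<\<beta>}" for y
    using D that by simp
  have b: "-\<beta> < \<beta>" using \<beta> by simp
  note FTC = set_integral_FTC_Ioo_nonneg[OF b D' c nonneg C]
  show "set_integrable lborel {-\<beta><..<\<beta>} f" by (rule FTC(1)) auto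
  have "(LBINT y:{-\<beta><..<\<beta>}. f y) = F \<beta> - F (-\<beta>)" by (rule FTC(2)) auto
  also have "\<dots> = 2 * \<beta> * (ln c + 1 - (a * ln a - b * ln b) / (a - b))"
    using \<beta> ab by (simp add: F_def L_def divide_simps) (simp add: algebra_simps)
  finally show "(LBINT y:{-\<beta><..<\<beta>}. f y) = 2 * \<beta> * (ln c + 1 - (a * ln a - b * ln b) / (a - b))" .
qed

text \<open>With \<open>P\<close> the \<open>n\<close>-th star power of \<open>x - i\<close>, \<open>disc_density n z\<close> is \<open>|P(x)|\<^sup>2\<close> at any unit \<open>x\<close> with
  \<open>fst x = z\<close>, and \<open>chord_integral n x\<close> is the integral of \<open>ln (4^n) - ln |P|\<^sup>2 \<ge> 0\<close> along the
  vertical chord of the disc at abscissa \<open>x\<close>.\<close>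

definition disc_density :: "nat \<Rightarrow> complex \<Rightarrow> real" where
  "disc_density n z = (let \<beta> = sqrt (1 - (Re z)\<^sup>2) in
     (1 + Im z / \<beta>) / 2 * (2 - 2 * \<beta>) ^ n + (1 - Im z / \<beta>) / 2 * (2 + 2 * \<beta>) ^ n)"

definition chord_integral :: "nat \<Rightarrow> real \<Rightarrow> real" where
  "chord_integral n x = (let \<beta> = sqrt (1 - x\<^sup>2); a = (2 - 2 * \<beta>) ^ n; b = (2 + 2 * \<beta>) ^ n in
     2 * \<beta> * (ln (4 ^ n) + 1 - (a * ln a - b * ln b) / (a - b)))"

lemma borel_measurable_disc_density [measurable]: "disc_density n \<in> borel_measurable borel"
  unfolding disc_density_def Let_def
  by measurable

lemma Complex_in_ball_iff:
  "Complex x y \<in> ball 0 1 \<longleftrightarrow> x \<in> {-1<..<1} \<and> y \<in> {- sqrt (1 - x\<^sup>2)<..<sqrt (1 - x\<^sup>2)}"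
proof -
  have "Complex x y \<in> ball 0 1 \<longleftrightarrow> y\<^sup>2 < 1 - x\<^sup>2"
    by (simp add: cmod_def less_diff_eq add.commute)
  also have "\<dots> \<longleftrightarrow> \<bar>y\<bar> < sqrt (1 - x\<^sup>2)"
    using real_sqrt_less_iff[of "y\<^sup>2" "1 - x\<^sup>2"] by simp
  also have "\<dots> \<longleftrightarrow> \<bar>x\<bar> < 1 \<and> \<bar>y\<bar> < sqrt (1 - x\<^sup>2)"
  proof -
    \<comment> \<open>Real \<open>sqrt\<close> is odd and strictly increasing on the whole line, so
      a positive root forces a positive argument.\<close>
    have "x\<^sup>2 < 1" if "\<bar>y\<bar> < sqrt (1 - x\<^sup>2)"
    proof -
      have "0 < sqrt (1 - x\<^sup>2)" using that by linarith
      then show ?thesis by simp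
    qed
    then show ?thesis by (auto simp: abs_square_less_1)
  qed
  finally show ?thesis by auto
qed

text \<open>The diameter x = 0 is excluded: there \<beta> = 1 and the smaller end value is 0, coming
  from the zero of P at i.\<close>

lemma chord_endpoints:
  fixes n :: nat and x :: real
  assumes n: "n \<ge> 1" and x: "\<bar>x\<bar> < 1" "x \<noteq> 0"
  defines "\<beta> \<equiv> sqrt (1 - x\<^sup>2)"
  shows "0 < \<beta>" "0 < (2 - 2 * \<beta>) ^ n" "(2 - 2 * \<beta>) ^ n < (2 + 2 * \<beta>) ^ n" "(2 + 2 * \<beta>) ^ n \<le> 4 ^ n"
proof -
  have "x\<^sup>2 < 1" using x by (simp add: abs_square_less_1)
  then show \<beta>: "0 < \<beta>" by (simp add: \<beta>_def)
  have "\<beta> < 1" unfolding \<beta>_def using x by (simp add: real_sqrt_lt_1_iff)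
  then show "0 < (2 - 2 * \<beta>) ^ n" "(2 + 2 * \<beta>) ^ n \<le> 4 ^ n"
    using \<beta> by (auto intro!: power_mono)
  show "(2 - 2 * \<beta>) ^ n < (2 + 2 * \<beta>) ^ n"
    using \<beta> \<open>\<beta> < 1\<close> n by (intro power_strict_mono) auto
qed

lemma
  fixes n :: nat and x :: real
  assumes n: "n \<ge> 1" and x: "\<bar>x\<bar> < 1" "x \<noteq> 0"
  shows nn_integral_chord:
      "(\<integral>\<^sup>+y. ennreal (ln (4 ^ n) - ln (disc_density n (Complex x y))) * indicator {- sqrt (1 - x\<^sup>2)<..<sqrt (1 - x\<^sup>2)} y \<partial>lborel) =
       ennreal (chord_integral n x)"
    and chord_integral_nonneg: "0 \<le> chord_integral n x"
proof -
  note e = chord_endpoints[OF assms]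
  note I = ln_linear_nonneg[OF e] set_integrable_ln_linear[OF e] integral_ln_linear[OF e]
  show "(\<integral>\<^sup>+y. ennreal (ln (4 ^ n) - ln (disc_density n (Complex x y))) * indicator {- sqrt (1 - x\<^sup>2)<..<sqrt (1 - x\<^sup>2)} y \<partial>lborel) =
       ennreal (chord_integral n x)"
    using nn_integral_eq_set_integral[OF I(2,1)] I(3)
    by (simp add: disc_density_def chord_integral_def Let_def)
  have "0 \<le> (LBINT y:{- sqrt (1 - x\<^sup>2)<..<sqrt (1 - x\<^sup>2)}.
      ln (4 ^ n) - ln ((1 + y / sqrt (1 - x\<^sup>2)) / 2 * (2 - 2 * sqrt (1 - x\<^sup>2)) ^ n +
        (1 - y / sqrt (1 - x\<^sup>2)) / 2 * (2 + 2 * sqrt (1 - x\<^sup>2)) ^ n))"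
    unfolding set_lebesgue_integral_def
    by (intro integral_nonneg_AE AE_I2) (use I(1) in \<open>auto split: split_indicator\<close>)
  then show "0 \<le> chord_integral n x"
    unfolding I(3) by (simp add: chord_integral_def Let_def)
qed

lemma ln_disc_density_le:
  fixes n :: nat and z :: complex
  assumes n: "n \<ge> 1" and z: "z \<in> ball 0 1"
  shows "ln (disc_density n z) \<le> ln (4 ^ n)"
proof -
  define \<beta> where "\<beta> = sqrt (1 - (Re z)\<^sup>2)"
  have b: "\<bar>Re z\<bar> < 1" "\<bar>Im z\<bar> < \<beta>"
    using z Complex_in_ball_iff[of "Re z" "Im z"] by (auto simp: \<beta>_def)
  have \<beta>: "0 < \<beta>" using b by linarith
  have \<beta>1: "\<beta> \<le> 1" unfolding \<beta>_def by simp
  have s: "0 < (1 + Im z / \<beta>) / 2" "0 < (1 - Im z / \<beta>) / 2" using b \<beta> by (auto simp: field_simps)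
  \<comment> \<open>Strict positivity comes from the second summand alone, since the first vanishes
    when \<beta> = 1.\<close>
  have "0 < disc_density n z"
    unfolding disc_density_def Let_def \<beta>_def[symmetric]
    using s \<beta> \<beta>1 by (intro add_nonneg_pos mult_pos_pos mult_nonneg_nonneg) auto
  moreover have "disc_density n z \<le> (1 + Im z / \<beta>) / 2 * 4 ^ n + (1 - Im z / \<beta>) / 2 * 4 ^ n"
    unfolding disc_density_def Let_def \<beta>_def[symmetric]
    using s \<beta> \<beta>1 by (intro add_mono mult_left_mono power_mono) auto
  moreover have "(1 + Im z / \<beta>) / 2 * 4 ^ n + (1 - Im z / \<beta>) / 2 * 4 ^ n = 4 ^ n"
    by (simp add: field_simps)
  ultimately show ?thesis by simp
qed

lemma ln_four_power: "ln (4 ^ n) = 2 * real n * ln (2::real)"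
proof -
  have "ln (4 ^ n :: real) = real n * ln (2 ^ 2)" by (simp add: ln_realpow)
  also have "ln (2 ^ 2 :: real) = 2 * ln 2" by (subst ln_realpow) auto
  finally show ?thesis by simp
qed

text \<open>Since 1 - tanh t = e^(-t) sech t and 1 + tanh t = e^t sech t, the end values are p/E and
  p E with p = (2 sech t)^n and E = e^(n t). The quotient in \<open>chord_integral\<close> becomes
  ln p + n t (E + 1/E)/(E - 1/E), which is where coth (n t) comes from.\<close>

lemma chord_integral_sech:
  fixes n :: nat and t :: real
  assumes n: "n \<ge> 1" and t: "0 < t"
  shows "chord_integral n (- (1 / cosh t)) =
     2 * tanh t * (real n * ln 2 + 1 + real n * ln (cosh t) - real n * (t * (cosh (real n * t) / sinh (real n * t))))"
proof -
  have "1 - (1 / cosh t)\<^sup>2 = (tanh t)\<^sup>2"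
    by (simp add: tanh_def power_divide sinh_square_eq diff_divide_distrib cosh_real_nz)
  then have \<beta>: "sqrt (1 - (- (1 / cosh t))\<^sup>2) = tanh t"
    using t by simp
  define p where "p = (2 / cosh t) ^ n"
  have p: "0 < p" by (simp add: p_def)
  have "2 - 2 * tanh t = 2 / cosh t * exp (- t)" "2 + 2 * tanh t = 2 / cosh t * exp t"
    by (simp_all add: tanh_def cosh_minus_sinh[symmetric] cosh_plus_sinh[symmetric] divide_simps cosh_real_nz)
  then have ab: "(2 - 2 * tanh t) ^ n = p * exp (- (real n * t))" "(2 + 2 * tanh t) ^ n = p * exp (real n * t)"
    by (simp_all only: p_def power_mult_distrib exp_of_nat_mult[symmetric] mult_minus_right)
  define E where "E = exp (real n * t)"
  have E: "1 < E" using n t by (simp add: E_def)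
  have Em: "exp (- (real n * t)) = 1 / E" by (simp add: E_def exp_minus divide_inverse)
  have ch: "cosh (real n * t) / sinh (real n * t) = (E + 1 / E) / (E - 1 / E)"
  proof -
    have "E + 1 / E = 2 * cosh (real n * t)" "E - 1 / E = 2 * sinh (real n * t)"
      by (simp_all add: cosh_def sinh_def Em E_def[symmetric])
    then show ?thesis by simp
  qed
  have d: "E - 1 / E \<noteq> 0" using E by (simp add: field_simps) (metis less_irrefl less_1_mult power2_eq_square)
  have quot: "(p * (1 / E) * (ln p - real n * t) - p * E * (ln p + real n * t)) / (p * (1 / E) - p * E) =
      ln p + real n * t * ((E + 1 / E) / (E - 1 / E))"
  proof -
    have "p * (1 / E) * (ln p - real n * t) - p * E * (ln p + real n * t) =
        - (p * ((E - 1 / E) * ln p + (E + 1 / E) * (real n * t)))"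
      by (simp add: algebra_simps)
    moreover have "p * (1 / E) - p * E = - (p * (E - 1 / E))"
      by (simp add: algebra_simps)
    moreover have "- (p * (q * l + r * m)) / - (p * q) = l + m * (r / q)" if "q \<noteq> 0" for q r l m :: real
      using p that by (simp add: field_simps)
    ultimately show ?thesis
      using d by (simp only: not_False_eq_True)
  qed
  have ln_ends: "ln (p * (1 / E)) = ln p - real n * t" "ln (p * E) = ln p + real n * t"
    using p E by (simp_all add: ln_mult ln_div E_def)
  have ln_p: "ln p = real n * ln 2 - real n * ln (cosh t)"
    by (simp add: p_def ln_realpow ln_div algebra_simps)
  show ?thesis
    unfolding chord_integral_def Let_def \<beta> ab Em E_def[symmetric] ch ln_ends quot
    unfolding ln_p ln_four_power by (simp add: algebra_simps)
qed

text \<open>The minus sign in x = - sech t makes the substitution increasing from the positive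
  half-line onto (-1, 0), with derivative tanh t sech t \<ge> 0. Together with the factor tanh t of
  the chord length this yields tanh^2 t sech t throughout, so only three integrals occur, of which
  \<open>C\<close> stays.\<close>

lemma
  fixes n :: nat
  assumes n: "n \<ge> 1"
  defines "C \<equiv> (LBINT t:{0<..}. t * (cosh (real n * t) / sinh (real n * t)) * (tanh t)\<^sup>2 * (1 / cosh t))"
  shows set_integrable_chord: "set_integrable lborel {-1<..<0} (chord_integral n)"
    and integral_chord: "(LBINT x:{-1<..<0}. chord_integral n x) =
      2 * (real n * pi / 2 * ln 2 + pi / 4 + real n * pi / 8 - real n * C)"
proof -
  let ?u = "\<lambda>t. (tanh t)\<^sup>2 / cosh t :: real"
  let ?v = "\<lambda>t. (tanh t)\<^sup>2 / cosh t * ln (cosh t) :: real"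
  let ?w = "\<lambda>t. t * (cosh (real n * t) / sinh (real n * t)) * (tanh t)\<^sup>2 * (1 / cosh t) :: real"
  let ?s = "\<lambda>t. (2 * (real n * ln 2 + 1)) * ?u t + (2 * real n) * ?v t - (2 * real n) * ?w t"
  let ?g = "\<lambda>t. - (1 / cosh t) :: real"
  let ?g' = "\<lambda>t. tanh t / cosh t :: real"
  have eq: "chord_integral n (?g t) * ?g' t = ?s t" if "0 < t" for t
    unfolding chord_integral_sech[OF n that] by (simp add: algebra_simps power2_eq_square)
  note i = set_integrable_tanh_sq_sech set_integrable_tanh_sq_sech_ln_cosh set_integrable_coth[OF n]
  have s: "set_integrable lborel {0<..} ?s"
    by (intro set_integral_diff set_integral_add set_integrable_mult_right i)
  have "(LBINT t:{0<..}. ?s t) =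
      (2 * (real n * ln 2 + 1)) * (pi / 4) + (2 * real n) * (pi / 4 * ln 2 + pi / 8) - (2 * real n) * C"
    by (simp only: set_integral_diff set_integral_add set_integrable_mult_right i set_integral_mult_right
        integral_tanh_sq_sech integral_tanh_sq_sech_ln_cosh C_def)
  also have "\<dots> = 2 * (real n * pi / 2 * ln 2 + pi / 4 + real n * pi / 8 - real n * C)"
    by (simp add: algebra_simps)
  finally have S: "(LBINT t:{0<..}. ?s t) = \<dots>" .
  have e: "einterval 0 \<infinity> = {0<..}" "einterval (ereal (-1)) (ereal 0) = {-1<..<0}"
    by (auto simp: einterval_def)
  have sg: "set_integrable lborel {0<..} (\<lambda>t. chord_integral n (?g t) * ?g' t)"
    using s by (subst set_integrable_cong[OF refl refl eq]) auto
  have x: "\<bar>?g t\<bar> < 1" "?g t \<noteq> 0" if "0 < t" for t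
  proof -
    have "1 < cosh t" using cosh_real_strict_mono[of 0 t] that by simp
    then show "\<bar>?g t\<bar> < 1" "?g t \<noteq> 0" by (auto simp: abs_mult)
  qed
  have cont: "isCont (chord_integral n) x" if x: "\<bar>x\<bar> < 1" "x \<noteq> 0" for x
  proof -
    note chord_endpoints[OF n x]
    then show ?thesis
      unfolding chord_integral_def Let_def by (auto intro!: continuous_intros)
  qed
  have A: "((ereal \<circ> ?g \<circ> real_of_ereal) \<longlongrightarrow> ereal (-1)) (at_right 0)"
  proof -
    have "(?g \<longlongrightarrow> -1) (at_right 0)" by real_asymp
    then have "((?g \<circ> real_of_ereal) \<longlongrightarrow> -1) (at_right 0)"
      unfolding zero_ereal_def by (simp add: ereal_tendsto_simps)
    then show ?thesis by (simp add: comp_def)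
  qed
  have B: "((ereal \<circ> ?g \<circ> real_of_ereal) \<longlongrightarrow> ereal 0) (at_left \<infinity>)"
  proof -
    have "(?g \<longlongrightarrow> 0) at_top" by real_asymp
    then have "((?g \<circ> real_of_ereal) \<longlongrightarrow> 0) (at_left \<infinity>)"
      by (simp add: ereal_tendsto_simps)
    then have "((\<lambda>x. ereal ((?g \<circ> real_of_ereal) x)) \<longlongrightarrow> ereal 0) (at_left \<infinity>)"
      by (intro tendsto_intros)
    then show ?thesis by (simp add: comp_def)
  qed
  have D: "(?g has_real_derivative ?g' t) (at t)" for t
    by (rule derivative_eq_intros refl | simp add: cosh_real_nz)+
      (simp add: tanh_def power2_eq_square)
  note sub = interval_integral_substitution_nonneg[where a = 0 and b = \<infinity> and f = "chord_integral n" and g = ?g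
      and g' = ?g', OF _ D _ _ _ _ A B, unfolded e]
  show "set_integrable lborel {-1<..<0} (chord_integral n)"
    by (rule sub(1)) (use sg in \<open>auto intro!: cont x chord_integral_nonneg[OF n] continuous_intros simp: cosh_real_nz\<close>)
  have "(LBINT x=ereal (-1)..ereal 0. chord_integral n x) = (LBINT t=0..\<infinity>. chord_integral n (?g t) * ?g' t)"
    by (rule sub(2)) (use sg in \<open>auto intro!: cont x chord_integral_nonneg[OF n] continuous_intros simp: cosh_real_nz\<close>)
  also have "\<dots> = (LBINT t:{0<..}. chord_integral n (?g t) * ?g' t)"
    by (rule interval_lebesgue_integral_0_infty)
  also have "\<dots> = (LBINT t:{0<..}. ?s t)"
    by (intro set_lebesgue_integral_cong allI impI) (simp, rule eq, simp)
  finally show "(LBINT x:{-1<..<0}. chord_integral n x) =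
      2 * (real n * pi / 2 * ln 2 + pi / 4 + real n * pi / 8 - real n * C)"
    unfolding S by (simp add: interval_lebesgue_integral_def e)
qed

text \<open>The disc contributes \<pi> ln (4^n) minus twice the half-disc integral \<open>W\<close>;
  the ln 2 of the comparison constant cancels exactly against the one produced by ln (cosh
  t).\<close>

lemma integral_ln_disc_density:
  fixes n :: nat
  assumes n: "n \<ge> 1"
  defines "C \<equiv> (LBINT t:{0<..}. t * (cosh (real n * t) / sinh (real n * t)) * (tanh t)\<^sup>2 * (1 / cosh t))"
  shows "(LBINT z:ball 0 1. ln (disc_density n z)) = 4 * real n * C - pi - real n * pi / 2"
proof -
  let ?h = "\<lambda>z. ln (4 ^ n) - ln (disc_density n z)"
  define W where "W = (LBINT x:{-1<..<0}. chord_integral n x)"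
  have i: "set_integrable lborel {-1<..<0} (chord_integral n)"
    by (rule set_integrable_chord[OF n])
  have c0: "0 \<le> chord_integral n x" if "x \<in> {-1<..<0}" for x
    using that by (intro chord_integral_nonneg[OF n]) auto
  have W0: "0 \<le> W"
    unfolding W_def set_lebesgue_integral_def
    by (intro integral_nonneg_AE AE_I2) (use c0 in \<open>auto split: split_indicator\<close>)
  have left: "(\<integral>\<^sup>+x. ennreal (chord_integral n x) * indicator {-1<..<0} x \<partial>lborel) = ennreal W"
    unfolding W_def by (rule nn_integral_eq_set_integral[OF i c0])
  have even: "chord_integral n (- x) = chord_integral n x" for x
    by (simp add: chord_integral_def)
  have [measurable]: "chord_integral n \<in> borel_measurable borel"
    unfolding chord_integral_def Let_def by measurable
  have [measurable]: "ball (0::complex) 1 \<in> sets borel" by simp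
  have "(\<integral>\<^sup>+z. ennreal (?h z) * indicator (ball 0 1) z \<partial>lborel) =
      (\<integral>\<^sup>+x. \<integral>\<^sup>+y. ennreal (?h (Complex x y)) * indicator (ball 0 1) (Complex x y) \<partial>lborel \<partial>lborel)"
    by (rule nn_integral_lborel_complex) measurable
  also have "\<dots> = (\<integral>\<^sup>+x. ennreal (chord_integral n x) * indicator {-1<..<0} x +
      ennreal (chord_integral n x) * indicator {0<..<1} x \<partial>lborel)"
  proof (intro nn_integral_cong_AE)
    show "AE x in lborel. (\<integral>\<^sup>+y. ennreal (?h (Complex x y)) * indicator (ball 0 1) (Complex x y) \<partial>lborel) =
        ennreal (chord_integral n x) * indicator {-1<..<0} x + ennreal (chord_integral n x) * indicator {0<..<1} x"
      using AE_lborel_singleton[of "0::real"]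
    proof eventually_elim
      case (elim x)
      have "(\<integral>\<^sup>+y. ennreal (?h (Complex x y)) * indicator (ball 0 1) (Complex x y) \<partial>lborel) =
          (\<integral>\<^sup>+y. ennreal (?h (Complex x y)) * indicator {- sqrt (1 - x\<^sup>2)<..<sqrt (1 - x\<^sup>2)} y * indicator {-1<..<1} x \<partial>lborel)"
        by (intro nn_integral_cong) (auto simp add: indicator_def Complex_in_ball_iff[unfolded mem_ball_0])
      also have "\<dots> = ennreal (chord_integral n x) * indicator {-1<..<1} x"
        using nn_integral_chord[OF n, of x] elim by (cases "x \<in> {-1<..<1}") (auto simp: abs_less_iff)
      finally show ?case using elim by (auto split: split_indicator)
    qed
  qed
  also have "\<dots> = (\<integral>\<^sup>+x. ennreal (chord_integral n x) * indicator {-1<..<0} x \<partial>lborel) +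
      (\<integral>\<^sup>+x. ennreal (chord_integral n x) * indicator {0<..<1} x \<partial>lborel)"
    by (rule nn_integral_add) measurable
  also have "(\<integral>\<^sup>+x. ennreal (chord_integral n x) * indicator {0<..<1} x \<partial>lborel) =
      (\<integral>\<^sup>+x. ennreal (chord_integral n x) * indicator {-1<..<0} x \<partial>lborel)"
    \<comment> \<open>Reflection x to -x, under which the chord integral is even.\<close>
    by (subst nn_integral_real_affine[where c = "-1" and t = 0])
      (auto intro!: nn_integral_cong simp: even split: split_indicator)
  also have "(\<integral>\<^sup>+x. ennreal (chord_integral n x) * indicator {-1<..<0} x \<partial>lborel) +
      (\<integral>\<^sup>+x. ennreal (chord_integral n x) * indicator {-1<..<0} x \<partial>lborel) = ennreal (2 * W)"
    unfolding left using W0 by (simp add: ennreal_plus[symmetric] del: ennreal_plus)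
  finally have nn: "(\<integral>\<^sup>+z. ennreal (?h z) * indicator (ball 0 1) z \<partial>lborel) = ennreal (2 * W)" .
  have hm: "set_borel_measurable lborel (ball 0 1) ?h"
    unfolding set_borel_measurable_def by measurable
  have h0: "0 \<le> ?h z" if "z \<in> ball 0 1" for z
    using ln_disc_density_le[OF n that] by simp
  have W2: "0 \<le> 2 * W" using W0 by simp
  note h = set_integral_from_nn_integral[OF hm h0 nn W2]
  have c: "set_integrable lborel (ball (0::complex) 1) (\<lambda>z. ln (4 ^ n :: real))"
    by (simp add: set_integrable_def emeasure_ball)
  have "(LBINT z:ball (0::complex) 1. ln (4 ^ n :: real)) = measure lborel (ball (0::complex) 1) * ln (4 ^ n)"
    by (simp add: set_lebesgue_integral_def)
  also have "measure lborel (ball (0::complex) 1) = pi"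
    by (simp add: measure_def emeasure_ball unit_ball_vol_2)
  finally have cv: "(LBINT z:ball (0::complex) 1. ln (4 ^ n :: real)) = pi * ln (4 ^ n)" .
  have "(LBINT z:ball 0 1. ln (4 ^ n) - ?h z) = pi * ln (4 ^ n) - 2 * W"
    by (simp only: set_integral_diff c h cv)
  moreover have "W = 2 * (real n * pi / 2 * ln 2 + pi / 4 + real n * pi / 8 - real n * C)"
    unfolding W_def C_def by (rule integral_chord[OF n])
  moreover have "ln (4 ^ n) = 2 * real n * ln 2"
    by (rule ln_four_power)
  ultimately show "(LBINT z:ball 0 1. ln (disc_density n z)) = 4 * real n * C - pi - real n * pi / 2"
    by (simp add: algebra_simps)
qed

section \<open>From the disc back to the Mahler measure\<close>

lemma integral_uniform_measure_disc:
  fixes f :: "complex \<Rightarrow> real"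
  assumes [measurable]: "f \<in> borel_measurable borel"
  shows "(\<integral>z. f z \<partial>uniform_measure lborel (ball 0 1)) = (LBINT z:ball 0 1. f z) / pi"
proof -
  have [measurable]: "ball (0::complex) 1 \<in> sets borel" by simp
  have "uniform_measure lborel (ball (0::complex) 1) = density lborel (\<lambda>z. ennreal (indicator (ball 0 1) z / pi))"
    unfolding uniform_measure_def
    by (intro density_cong)
      (auto simp: emeasure_ball unit_ball_vol_2 divide_ennreal[symmetric] split: split_indicator)
  then have "(\<integral>z. f z \<partial>uniform_measure lborel (ball 0 1)) = (\<integral>z. (indicator (ball 0 1) z / pi) *\<^sub>R f z \<partial>lborel)"
    by (simp add: integral_density)
  also have "\<dots> = (LBINT z:ball 0 1. f z) / pi"
    by (simp add: set_lebesgue_integral_def)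
  finally show ?thesis .
qed

text \<open>The denominator combines the disc area \<pi> with the 2 from ln |P|^2 = 2 ln |P|. Almost
  every x projects into the open disc, which ensures \<beta> > 0.\<close>

lemma mahler_H_star_pow:
  "mahler_H (star_pow x_minus_i n) = (LBINT z:ball 0 1. ln (disc_density n z)) / (2 * pi)"
proof -
  have f [measurable]: "(fst :: quat \<Rightarrow> complex) \<in> borel_measurable borel"
    by (intro borel_measurable_continuous_onI continuous_intros)
  have s [measurable_cong]: "sets haar_S3 = sets borel"
    by (simp add: haar_S3_def)
  have "AE z in uniform_measure lborel (ball (0::complex) 1). z \<in> ball 0 1"
    by (intro AE_uniform_measureI) auto
  then have "AE x in haar_S3. fst x \<in> ball 0 1"
    unfolding distr_haar_S3_fst[symmetric] by (subst (asm) AE_distr_iff) auto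
  then have "AE x in haar_S3. ln (norm (sr_eval (star_pow x_minus_i n) x)) = ln (disc_density n (fst x)) / 2"
    using AE_haar_S3_norm
  proof eventually_elim
    case (elim x)
    have "sqrt (1 - (Re (fst x))\<^sup>2) > 0"
      using elim Complex_in_ball_iff[of "Re (fst x)" "Im (fst x)"] by (auto simp: abs_square_less_1)
    then have "(norm (sr_eval (star_pow x_minus_i n) x))\<^sup>2 = disc_density n (fst x)"
      using norm_sr_eval_star_pow[OF elim(2) refl] by (simp add: disc_density_def Let_def)
    \<comment> \<open>At r = 0 the identity holds through the default \<open>ln 0 = 0\<close>, so
      the zero of P needs no separate treatment.\<close>
    moreover have "ln (r\<^sup>2) = 2 * ln r" if "0 \<le> r" for r :: real
      using that by (cases "r = 0") (auto simp: ln_realpow)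
    ultimately show ?case by (metis nonzero_mult_div_cancel_left norm_ge_zero zero_neq_numeral)
  qed
  then have "mahler_H (star_pow x_minus_i n) = (\<integral>x. ln (disc_density n (fst x)) / 2 \<partial>haar_S3)"
    unfolding mahler_H_def by (intro integral_cong_AE) measurable
  also have "\<dots> = (\<integral>z. ln (disc_density n z) / 2 \<partial>distr haar_S3 borel fst)"
    by (subst integral_distr) auto
  also have "\<dots> = (LBINT z:ball 0 1. ln (disc_density n z) / 2) / pi"
    unfolding distr_haar_S3_fst by (rule integral_uniform_measure_disc) measurable
  finally show ?thesis by simp
qed

lemma star_pow_x_minus_i_2:
  "star_pow x_minus_i 2 = (\<lambda>l. if l = 2 then qone else if l = 1 then (-2) *\<^sub>R qi else if l = 0 then - qone else 0)"
proof
  fix l :: nat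
  consider "l = 0" | "l = 1" | "l = 2" | "l > 2" by linarith
  then show "star_pow x_minus_i 2 l = (if l = 2 then qone else if l = 1 then (-2) *\<^sub>R qi else if l = 0 then - qone else 0)"
    by cases (auto simp: star_pow_x_minus_i qone_def qi_def zero_prod_def scaleR_conv_of_real)
qed

lemma star_pow_x_minus_i_3:
  "star_pow x_minus_i 3 = (\<lambda>l. if l = 3 then qone else if l = 2 then (-3) *\<^sub>R qi
     else if l = 1 then (-3) *\<^sub>R qone else if l = 0 then qi else 0)"
proof
  fix l :: nat
  have b: "(3::nat) choose 2 = 3" by (simp add: eval_nat_numeral)
  consider "l = 0" | "l = 1" | "l = 2" | "l = 3" | "l > 3" by linarith
  then show "star_pow x_minus_i 3 l = (if l = 3 then qone else if l = 2 then (-3) *\<^sub>R qi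
     else if l = 1 then (-3) *\<^sub>R qone else if l = 0 then qi else 0)"
    by cases (auto simp: star_pow_x_minus_i b qone_def qi_def zero_prod_def scaleR_conv_of_real power3_eq_cube)
qed

theorem theorem1p3:
  shows "(\<forall>n::nat. n \<ge> 1 \<longrightarrow>
           mahler_H (star_pow x_minus_i n) =
             2 * real n / pi *
               (LBINT t:{0<..}. t * (cosh (real n * t) / sinh (real n * t))
                                  * (tanh t)\<^sup>2 * (1 / cosh t))
             - (2 + real n) / 4)
       \<and> mahler_H (\<lambda>l. if l = 2 then qone else if l = 1 then (-2) *\<^sub>R qi
                       else if l = 0 then - qone else 0) = 5 / 6
       \<and> mahler_H (\<lambda>l. if l = 3 then qone else if l = 2 then (-3) *\<^sub>R qi
                       else if l = 1 then (-3) *\<^sub>R qone else if l = 0 then qi else 0)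
           = 31 / 4 - 2 * pi"
proof -
  have main: "mahler_H (star_pow x_minus_i n) =
      2 * real n / pi * (LBINT t:{0<..}. t * (cosh (real n * t) / sinh (real n * t)) * (tanh t)\<^sup>2 * (1 / cosh t))
      - (2 + real n) / 4" if "n \<ge> 1" for n
    unfolding mahler_H_star_pow integral_ln_disc_density[OF that]
    by (simp add: field_simps)
  have "mahler_H (star_pow x_minus_i 2) = 5 / 6"
    by (subst main) (simp_all only: integral_coth_2, simp_all add: field_simps)
  moreover have "mahler_H (star_pow x_minus_i 3) = 31 / 4 - 2 * pi"
    by (subst main) (simp_all only: integral_coth_3, simp_all add: field_simps power2_eq_square)
  ultimately show ?thesis
    using main unfolding star_pow_x_minus_i_2 star_pow_x_minus_i_3 by blast
qed

end
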